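(* Suppose the star-connected occupied component $C(0)$ containing the origin is finite. Let $\Lambda_0$ be the set of all vacant squares that share a corner with some occupied square in $C(0)$. Then there exists a unique plus connected $S$-cycle $G_{out} = (Y_1,\dots,Y_t)$ with the following properties: (i) For every $i$, $1 \leq i \leq t$, the square $Y_i \in \{S_k\}_{k\ge 0}$ is in $\Lambda_0$. (ii) The outermost boundary of $G_{out}$ is a single cycle $\partial_G$. (iii) If $S_k \in C(0)\cup \Lambda_0$, then either $S_k$ is in $G_{out}$ (i.e. $S_k = Y_i$ for some $i$) or $S_k$ is contained in the interior of $\partial_G$.
   Context: Tile $\mathbb{R}^2$ into unit squares $\{S_k\}_{k\ge 0}$ with disjoint interiors (the standard square grid with sides parallel to the axes), the origin being the centre of $S_0$. Two distinct squares are star-adjacent (or simply adjacent) if they share a corner, and plus-adjacent if they share an edge. Every square is assigned one of two states, occupied or vacant (the assignment is arbitrary). The star-connected occupied component $C(0)$ containing the origin: if $S_0$ is vacant, $C(0)=\emptyset$; otherwise $C(0)$ is the set of all occupied squares $S$ for which there is a sequence of distinct occupied squares starting at $S_0$ and ending at $S$, with consecutive squares star-adjacent. Plus connected $S$-cycle: for a set of squares $\{J_i\}_{1\le i\le m}$ in $\{S_k\}_{k\ge0}$, the sequence $(J_1,\dots,J_m)$ is a plus connected $S$-path if $J_i$ is plus-adjacent to $J_{i+1}$ for each $1\le i\le m-1$; it is a plus connected $S$-cycle if in addition $J_m$ is plus-adjacent to $J_1$. Outermost boundary: let $L$ be a finite star- or plus-connected collection of squares (for a sequence of squares, take the collection of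 squares occurring in it; these are regarded as occupied and all other squares as vacant). Let $G_L$ be the graph whose vertices are the corners, and whose edges are the edges, of the squares in $L$. A cycle in $G_L$ is a closed path $(v_0,v_1,\dots,v_m,v_0)$ with $v_0,\dots,v_m$ distinct and consecutive vertices joined by an edge of $G_L$. A cycle divides the plane into a bounded connected region (its interior) and an unbounded connected region (its exterior). An edge $e$ of $G_L$ is an outermost boundary edge if for every cycle $C$ in $G_L$, either $e$ is an edge of $C$ or $e$ belongs to the exterior of $C$. The outermost boundary of $L$ is the set of all outermost boundary edges of $G_L$; saying that it is a single cycle means that it is the edge set of one cycle. A square is contained in the interior (resp. lies in the exterior) of a cycle if its open interior is contained in the bounded (resp. unbounded) region; an edge is in the exterior (resp. interior) if the edge without its endpoints is in the unbounded (resp. bounded) region.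
   Formalization: The origin's square is assumed occupied (if C(0) is empty no such cycle exists), and "unique" is replaced by uniqueness of the outermost boundary and of the set of squares of the cycle having an edge on it, since the sequence, and even its set of squares, need not be unique. *)

theory Defs
  imports "HOL-Analysis.Analysis"
begin

text \<open>
  The plane is \<^typ>\<open>complex\<close>. The squares of the tiling are indexed by their centres
  \<open>(i, j)\<close>, so \<open>(0, 0)\<close> is the square centred at the origin.
\<close>

type_synonym sq = "int \<times> int"

definition square :: "sq \<Rightarrow> complex set" where
  "square S = cbox (Complex (of_int (fst S) - 1/2) (of_int (snd S) - 1/2))
                   (Complex (of_int (fst S) + 1/2) (of_int (snd S) + 1/2))"

definition corners :: "sq \<Rightarrow> complex set" where
  "corners S = {Complex (of_int (fst S) + a) (of_int (snd S) + b) | a b.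
                  a \<in> {-1/2, 1/2} \<and> b \<in> {-1/2, 1/2}}"

text \<open>An edge is represented by the set of its two endpoints.\<close>

definition edges :: "sq \<Rightarrow> complex set set" where
  "edges S = {{p, q} | p q. p \<in> corners S \<and> q \<in> corners S \<and> dist p q = 1}"

definition star_adj :: "sq \<Rightarrow> sq \<Rightarrow> bool" where
  "star_adj S T \<longleftrightarrow> S \<noteq> T \<and> corners S \<inter> corners T \<noteq> {}"

definition plus_adj :: "sq \<Rightarrow> sq \<Rightarrow> bool" where
  "plus_adj S T \<longleftrightarrow> S \<noteq> T \<and> edges S \<inter> edges T \<noteq> {}"

text \<open>A configuration is given by its set \<open>occ\<close> of occupied squares.\<close>

definition origin_component :: "sq set \<Rightarrow> sq set" where
  "origin_component occ =
     {S. \<exists>ss. ss \<noteq> [] \<and> hd ss = (0, 0) \<and> last ss = S \<and> distinct ss \<and>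
              set ss \<subseteq> occ \<and> successively star_adj ss}"

definition vacant_boundary :: "sq set \<Rightarrow> sq set" where
  "vacant_boundary occ = {S. S \<notin> occ \<and> (\<exists>T \<in> origin_component occ. star_adj S T)}"

text \<open>Squares may be repeated in an S-path or S-cycle.\<close>

definition plus_S_path :: "sq list \<Rightarrow> bool" where
  "plus_S_path ss \<longleftrightarrow> ss \<noteq> [] \<and> successively plus_adj ss"

definition plus_S_cycle :: "sq list \<Rightarrow> bool" where
  "plus_S_cycle ss \<longleftrightarrow> plus_S_path ss \<and> plus_adj (last ss) (hd ss)"

definition graph_edges :: "sq set \<Rightarrow> complex set set" where
  "graph_edges L = (\<Union>S \<in> L. edges S)"

definition cycle_edges :: "complex list \<Rightarrow> complex set set" where
  "cycle_edges vs = {{vs ! i, vs ! (Suc i mod length vs)} | i. i < length vs}"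

text \<open>
  The closed path is given by its distinct vertices, the first one not being repeated at the end.
  The length bound rules out an edge traversed back and forth, which encloses no region.
\<close>

definition graph_cycle :: "sq set \<Rightarrow> complex list \<Rightarrow> bool" where
  "graph_cycle L vs \<longleftrightarrow> 3 \<le> length vs \<and> distinct vs \<and> cycle_edges vs \<subseteq> graph_edges L"

text \<open>
  The point set covered by a set of edges; the convex hull of two endpoints is the segment
  between them. The interior and the exterior of a cycle are the library's
  \<^const>\<open>inside\<close> and \<^const>\<open>outside\<close> of this point set.
\<close>

definition curve :: "complex set set \<Rightarrow> complex set" where
  "curve B = (\<Union>e \<in> B. convex hull e)"

definition outermost_boundary :: "sq set \<Rightarrow> complex set set" where
  "outermost_boundary L =
     {e \<in> graph_edges L. \<forall>vs. graph_cycle L vs \<longrightarrow>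
        e \<in> cycle_edges vs \<or> convex hull e - e \<subseteq> outside (curve (cycle_edges vs))}"

definition enclosing_S_cycle :: "sq set \<Rightarrow> sq list \<Rightarrow> bool" where
  "enclosing_S_cycle occ ys \<longleftrightarrow>
     plus_S_cycle ys \<and>
     set ys \<subseteq> vacant_boundary occ \<and>
     (\<exists>vs. graph_cycle (set ys) vs \<and> outermost_boundary (set ys) = cycle_edges vs) \<and>
     (\<forall>S \<in> origin_component occ \<union> vacant_boundary occ.
        S \<in> set ys \<or> interior (square S) \<subseteq> inside (curve (outermost_boundary (set ys))))"

text \<open>
  The conditions in \<^const>\<open>enclosing_S_cycle\<close> do not determine the sequence, not even up
  to rotation and reversal, nor its set of squares. For the origin component
  \<open>{(0,0), (1,-1), (2,-1), (3,0)}\<close> the cycle through \<open>(0,1), (1,1), (2,1), (3,1)\<close> may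
  make the detour \<open>(1,1), (1,0), (2,0), (2,1)\<close>. What is determined is the outermost boundary
  and the set of squares of the cycle that have an edge on it.
\<close>

definition bordering_squares :: "sq set \<Rightarrow> sq set" where
  "bordering_squares L = {S \<in> L. edges S \<inter> outermost_boundary L \<noteq> {}}"

end

theory Submission
  imports Defs
begin

text \<open>
  One planar fact, \<open>boundary_fill_is_cycle\<close>, is used on two scales: if a finite plus-connected set
  of lattice cells is completed by its holes, the boundary of the result is a single simple lattice
  cycle. All degrees in such a boundary are even, so it contains a simple cycle \<open>O\<close>. The parity of
  ray crossings shows that \<open>O\<close> bounds a finite set of cells. The boundary of that set is part of the
  boundary of the filling, so the set is adjacent to no other filled cell, and connectedness forces
  it to be the whole filling.

  Existence uses the lattice whose vertices are the squares and whose cells are the corners of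
  squares. The corners of the squares of \<open>C(0)\<close> are plus-connected there, because star-adjacent
  squares share a corner. The boundary of their filling is a simple closed path through squares, that
  is, a plus-connected S-cycle without repetitions. Its squares touch \<open>C(0)\<close> without belonging to
  it, and it encloses \<open>C(0)\<close> and all squares that touch \<open>C(0)\<close> (\<open>surrounding_cycle\<close>).

  The planar fact for the lattice whose cells are the squares describes the outermost boundary of an
  arbitrary S-cycle with set of squares \<open>L\<close>: it is the boundary of the filling of \<open>L\<close>, and it is a
  single cycle (\<open>outermost_boundary_is_cycle\<close>). The topology needed for this is modest: filled
  squares are inside the boundary curve, because off the curve their union is open and closed, and
  unfilled squares are outside every cycle of the graph, because a bounded component of the
  complement would yield another hole.

  Consequently an enclosing cycle is one whose squares are in \<open>\<Lambda>\<^sub>0\<close> and whose filling contains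
  \<open>C(0) \<union> \<Lambda>\<^sub>0\<close> (\<open>interior_inside_iff_filled\<close>). Filling is a closure operator, so for every such cycle
  the filling is that of \<open>C(0) \<union> \<Lambda>\<^sub>0\<close>; it determines the outermost boundary and the squares bordering
  on it.
\<close>

section \<open>Cells, edges and boundaries in the integer lattice\<close>

definition hedge :: "sq \<Rightarrow> sq set" where
  "hedge v = {v, (fst v + 1, snd v)}"

definition vedge :: "sq \<Rightarrow> sq set" where
  "vedge v = {v, (fst v, snd v + 1)}"

definition cell_edges :: "sq \<Rightarrow> sq set set" where
  "cell_edges S = {hedge S, hedge (fst S, snd S + 1), vedge S, vedge (fst S + 1, snd S)}"

definition cell_boundary :: "sq set \<Rightarrow> sq set set" where
  "cell_boundary X = {e. \<exists>S\<in>X. \<exists>T. T \<notin> X \<and> e \<in> cell_edges S \<and> e \<in> cell_edges T}"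

lemma hedge_eq_iff [simp]: "hedge v = hedge w \<longleftrightarrow> v = w"
  by (cases v; cases w) (auto simp: hedge_def doubleton_eq_iff)

lemma vedge_eq_iff [simp]: "vedge v = vedge w \<longleftrightarrow> v = w"
  by (cases v; cases w) (auto simp: vedge_def doubleton_eq_iff)

lemma hedge_neq_vedge [simp]: "hedge v \<noteq> vedge w" "vedge w \<noteq> hedge v"
  by (cases v; cases w; auto simp: hedge_def vedge_def doubleton_eq_iff)+

lemma hedge_in_cell_edges: "hedge (i, j) \<in> cell_edges S \<longleftrightarrow> S = (i, j) \<or> S = (i, j - 1)"
  by (cases S) (auto simp: cell_edges_def)

lemma vedge_in_cell_edges: "vedge (i, j) \<in> cell_edges S \<longleftrightarrow> S = (i, j) \<or> S = (i - 1, j)"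
  by (cases S) (auto simp: cell_edges_def)

lemma cell_edges_cases:
  assumes "e \<in> cell_edges S"
  obtains i j where "e = hedge (i, j)" | i j where "e = vedge (i, j)"
  using assms by (cases S) (auto simp: cell_edges_def)

lemma hedge_in_cell_boundary:
  "hedge (i, j) \<in> cell_boundary X \<longleftrightarrow> ((i, j) \<in> X) \<noteq> ((i, j - 1) \<in> X)"
  by (auto simp: cell_boundary_def hedge_in_cell_edges)

lemma vedge_in_cell_boundary:
  "vedge (i, j) \<in> cell_boundary X \<longleftrightarrow> ((i, j) \<in> X) \<noteq> ((i - 1, j) \<in> X)"
  by (auto simp: cell_boundary_def vedge_in_cell_edges)

lemma cell_boundary_cases:
  assumes "e \<in> cell_boundary X"
  obtains i j where "e = hedge (i, j)" | i j where "e = vedge (i, j)"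
  using assms cell_edges_cases unfolding cell_boundary_def by blast

lemma cell_boundary_lattice: "cell_boundary X \<subseteq> range hedge \<union> range vedge"
  by (auto elim: cell_boundary_cases)

section \<open>Squares of the plane as lattice cells\<close>

text \<open>
  The vertex \<open>v\<close> of the integer lattice becomes the lower left corner of the square \<open>v\<close>, so that the
  lattice cell \<open>S\<close> becomes the square \<open>S\<close>.
\<close>

definition lattice_point :: "sq \<Rightarrow> complex" where
  "lattice_point v = Complex (of_int (fst v) - 1/2) (of_int (snd v) - 1/2)"

lemma inj_lattice_point: "inj lattice_point"
  by (auto simp: inj_def lattice_point_def prod_eq_iff)

lemma inj_image_lattice_point: "inj ((`) lattice_point)"
  by (simp add: inj_def inj_image_eq_iff[OF inj_lattice_point])

lemma corners_eq:
  "corners S = lattice_point ` {S, (fst S + 1, snd S), (fst S, snd S + 1), (fst S + 1, snd S + 1)}"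
proof -
  have split: "(\<exists>a b. z = f a b \<and> a \<in> {x, y} \<and> b \<in> {x, y}) \<longleftrightarrow>
      z \<in> {f x x, f y x, f x y, f y y}" for z :: complex and f and x y :: real
    by blast
  have "corners S = {Complex (of_int (fst S) - 1/2) (of_int (snd S) - 1/2),
      Complex (of_int (fst S) + 1/2) (of_int (snd S) - 1/2),
      Complex (of_int (fst S) - 1/2) (of_int (snd S) + 1/2),
      Complex (of_int (fst S) + 1/2) (of_int (snd S) + 1/2)}"
    unfolding corners_def split by auto
  then show ?thesis
    by (simp add: lattice_point_def add.commute)
qed

lemma dist_lattice_point_eq_1:
  "dist (lattice_point (i, j)) (lattice_point (k, l)) = 1 \<longleftrightarrow> (i - k)\<^sup>2 + (j - l)\<^sup>2 = 1"
proof -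
  have "dist (lattice_point (i, j)) (lattice_point (k, l)) = sqrt (of_int ((i - k)\<^sup>2 + (j - l)\<^sup>2))"
    by (simp add: lattice_point_def dist_norm cmod_def)
  also have "\<dots> = 1 \<longleftrightarrow> (i - k)\<^sup>2 + (j - l)\<^sup>2 = 1"
    using of_int_eq_1_iff[of "(i - k)\<^sup>2 + (j - l)\<^sup>2", where 'a = real]
    by (simp only: real_sqrt_eq_1_iff)
  finally show ?thesis .
qed

lemma edges_eq: "edges S = (`) lattice_point ` cell_edges S"
proof -
  obtain i j where S: "S = (i, j)"
    by (cases S)
  define V where "V = {(i, j), (i + 1, j), (i, j + 1), (i + 1, j + 1)}"
  have corners: "corners S = lattice_point ` V"
    by (simp add: corners_eq S V_def)
  have unit: "lattice_point ` {u, v} \<in> edges S"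
    if "u \<in> V" "v \<in> V" "(fst u - fst v)\<^sup>2 + (snd u - snd v)\<^sup>2 = 1" for u v
  proof -
    have "dist (lattice_point u) (lattice_point v) = 1"
      using that(3) dist_lattice_point_eq_1[of "fst u" "snd u" "fst v" "snd v"] by simp
    with that(1,2) show ?thesis
      unfolding edges_def corners by (intro CollectI exI[of _ "lattice_point u"] exI[of _ "lattice_point v"]) auto
  qed
  show ?thesis
  proof
    show "edges S \<subseteq> (`) lattice_point ` cell_edges S"
    proof
      fix e assume "e \<in> edges S"
      then obtain u v where uv: "u \<in> V" "v \<in> V" "dist (lattice_point u) (lattice_point v) = 1"
        "e = lattice_point ` {u, v}"
        unfolding edges_def corners by auto
      have "{u, v} \<in> cell_edges S"
        using uv(1-3) unfolding V_def
        by (elim insertE emptyE)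
          (simp_all add: dist_lattice_point_eq_1 cell_edges_def hedge_def vedge_def S insert_commute)
      with uv(4) show "e \<in> (`) lattice_point ` cell_edges S"
        by (rule image_eqI)
    qed
    show "(`) lattice_point ` cell_edges S \<subseteq> edges S"
      using unit[of "(i, j)" "(i + 1, j)"] unit[of "(i, j + 1)" "(i + 1, j + 1)"]
        unit[of "(i, j)" "(i, j + 1)"] unit[of "(i + 1, j)" "(i + 1, j + 1)"]
      by (simp add: cell_edges_def hedge_def vedge_def S V_def)
  qed
qed

lemma star_adj_iff:
  "star_adj (i, j) (k, l) \<longleftrightarrow> (i, j) \<noteq> (k, l) \<and> \<bar>i - k\<bar> \<le> 1 \<and> \<bar>j - l\<bar> \<le> 1"
proof -
  have "corners (i, j) \<inter> corners (k, l) \<noteq> {} \<longleftrightarrow>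
      ({i, i + 1} \<times> {j, j + 1}) \<inter> ({k, k + 1} \<times> {l, l + 1}) \<noteq> {}"
    unfolding corners_eq image_Int[OF inj_lattice_point, symmetric]
    by (simp add: Sigma_def Un_commute insert_commute)
  also have "\<dots> \<longleftrightarrow> {i, i + 1} \<inter> {k, k + 1} \<noteq> {} \<and> {j, j + 1} \<inter> {l, l + 1} \<noteq> {}"
    by blast
  also have "\<dots> \<longleftrightarrow> \<bar>i - k\<bar> \<le> 1 \<and> \<bar>j - l\<bar> \<le> 1"
  proof -
    have "{i, i + 1} \<inter> {k, k + 1} \<noteq> {} \<longleftrightarrow> \<bar>i - k\<bar> \<le> 1" for i k :: int
      by auto
    then show ?thesis by simp
  qed
  finally show ?thesis
    by (simp add: star_adj_def)
qed

lemma plus_adj_eq: "plus_adj S T \<longleftrightarrow> S \<noteq> T \<and> cell_edges S \<inter> cell_edges T \<noteq> {}"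
  unfolding plus_adj_def edges_eq image_Int[OF inj_image_lattice_point, symmetric] by simp

lemma plus_adj_neighbours:
  "plus_adj (i, j) t \<longleftrightarrow> t \<in> {(i + 1, j), (i - 1, j), (i, j + 1), (i, j - 1)}"
proof -
  have "cell_edges (i, j) \<inter> cell_edges t \<noteq> {} \<longleftrightarrow>
      hedge (i, j) \<in> cell_edges t \<or> hedge (i, j + 1) \<in> cell_edges t \<or>
      vedge (i, j) \<in> cell_edges t \<or> vedge (i + 1, j) \<in> cell_edges t"
    unfolding cell_edges_def[of "(i, j)"] by simp
  then show ?thesis
    unfolding plus_adj_eq by (cases t) (auto simp: hedge_in_cell_edges vedge_in_cell_edges)
qed

lemma plus_adj_iff:
  "plus_adj (i, j) (k, l) \<longleftrightarrow> i = k \<and> \<bar>j - l\<bar> = 1 \<or> j = l \<and> \<bar>i - k\<bar> = 1"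
  unfolding plus_adj_neighbours by simp arith

lemma plus_adj_sym: "plus_adj S T \<longleftrightarrow> plus_adj T S"
  by (auto simp: plus_adj_def)

lemma star_adj_sym: "star_adj S T \<longleftrightarrow> star_adj T S"
  by (auto simp: star_adj_def)

lemma cell_boundary_iff_plus_adj:
  assumes "plus_adj S T" "e \<in> cell_edges S" "e \<in> cell_edges T"
  shows "e \<in> cell_boundary X \<longleftrightarrow> (S \<in> X) \<noteq> (T \<in> X)"
  using assms(2)
proof (cases rule: cell_edges_cases)
  case (1 i j)
  with assms have "{S, T} = {(i, j), (i, j - 1)}"
    by (auto simp: hedge_in_cell_edges plus_adj_def)
  with 1 show ?thesis
    by (auto simp: hedge_in_cell_boundary doubleton_eq_iff)
next
  case (2 i j)
  with assms have "{S, T} = {(i, j), (i - 1, j)}"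
    by (auto simp: vedge_in_cell_edges plus_adj_def)
  with 2 show ?thesis
    by (auto simp: vedge_in_cell_boundary doubleton_eq_iff)
qed

lemma cell_boundaryE:
  assumes "e \<in> cell_boundary X"
  obtains S T where "S \<in> X" "T \<notin> X" "plus_adj S T" "e \<in> cell_edges S" "e \<in> cell_edges T"
  using assms by (fastforce simp: cell_boundary_def plus_adj_eq)

lemma cell_boundaryI:
  assumes "S \<in> X" "T \<notin> X" "plus_adj S T"
  obtains e where "e \<in> cell_boundary X" "e \<in> cell_edges S" "e \<in> cell_edges T"
  using assms that unfolding cell_boundary_def plus_adj_eq by blast

lemma finite_cell_boundary:
  assumes "finite X"
  shows "finite (cell_boundary X)"
proof (rule finite_subset)
  show "cell_boundary X \<subseteq> (\<Union>S\<in>X. cell_edges S)"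
    by (auto simp: cell_boundary_def)
  show "finite (\<Union>S\<in>X. cell_edges S)"
    using assms by (auto simp: cell_edges_def)
qed

section \<open>Filling the holes of a set of cells\<close>

text \<open>
  A finite set has a rightmost cell, whose right-hand neighbour would belong to it as well.
\<close>

lemma finite_closed_set_empty:
  assumes "finite X" and closed: "\<And>x t. x \<in> X \<Longrightarrow> plus_adj x t \<Longrightarrow> t \<in> X"
  shows "X = {}"
proof (rule ccontr)
  assume "X \<noteq> {}"
  define m where "m = Max (fst ` X)"
  have "m \<in> fst ` X"
    unfolding m_def using assms(1) \<open>X \<noteq> {}\<close> by (intro Max_in) auto
  then obtain j where "(m, j) \<in> X"
    by force
  then have "(m + 1, j) \<in> X"
    using closed by (auto simp: plus_adj_iff)
  then have "m + 1 \<le> m"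
    using Max_ge[of "fst ` X" "m + 1"] assms(1) unfolding m_def by force
  then show False
    by simp
qed

text \<open>
  A union of bounded plus-components of the complement of \<open>L\<close>: a plus-path that leaves \<open>X\<close>
  can only enter \<open>L\<close>. Describing holes by such closed finite sets replaces all reasoning about
  paths to infinity.
\<close>

definition hole_of :: "sq set \<Rightarrow> sq set \<Rightarrow> bool" where
  "hole_of L X \<longleftrightarrow> finite X \<and> X \<inter> L = {} \<and> (\<forall>x\<in>X. \<forall>t. plus_adj x t \<longrightarrow> t \<in> X \<union> L)"

definition fill :: "sq set \<Rightarrow> sq set" where
  "fill L = L \<union> \<Union> {X. hole_of L X}"

lemma subset_fill: "L \<subseteq> fill L"
  by (auto simp: fill_def)

lemma hole_subset_fill: "hole_of L X \<Longrightarrow> X \<subseteq> fill L"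
  by (auto simp: fill_def)

lemma fill_exit:
  assumes "x \<in> fill L" "t \<notin> fill L" "plus_adj x t"
  shows "x \<in> L"
proof (rule ccontr)
  assume "x \<notin> L"
  with assms(1) obtain X where X: "hole_of L X" "x \<in> X"
    by (auto simp: fill_def)
  with assms(3) have "t \<in> X \<union> L"
    unfolding hole_of_def by blast
  with X(1) assms(2) show False
    by (auto simp: fill_def)
qed

text \<open>
  A cell of \<open>X\<close> that maximises \<open>f\<close> cannot be improved inside \<open>X\<close>. With \<open>f\<close> one of the four
  signed coordinates this confines holes to a box around \<open>L\<close>.
\<close>

lemma hole_coordinate_bound:
  fixes f :: "sq \<Rightarrow> int"
  assumes "finite X" and step: "\<And>x. x \<in> X \<Longrightarrow> n < f x \<Longrightarrow> \<exists>t\<in>X. f x < f t"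
  shows "\<forall>x\<in>X. f x \<le> n"
proof (rule ccontr)
  assume "\<not> ?thesis"
  then obtain y where y: "y \<in> X" "n < f y"
    by (auto simp: not_le)
  have "Max (f ` X) \<in> f ` X"
    using assms(1) y(1) by (intro Max_in) auto
  then obtain x where x: "x \<in> X" "f x = Max (f ` X)"
    by auto
  have max: "f t \<le> f x" if "t \<in> X" for t
    using assms(1) that by (simp add: x(2))
  obtain t where "t \<in> X" "f x < f t"
    using step[OF x(1)] y(2) max[OF y(1)] by auto
  with max[of t] show False
    by simp
qed

lemma finite_fill:
  assumes "finite L"
  shows "finite (fill L)"
proof -
  obtain n where n: "\<forall>S\<in>L. \<bar>fst S\<bar> \<le> n \<and> \<bar>snd S\<bar> \<le> n"
  proof
    show "\<forall>S\<in>L. \<bar>fst S\<bar> \<le> (\<Sum>S\<in>L. \<bar>fst S\<bar> + \<bar>snd S\<bar>) \<and> \<bar>snd S\<bar> \<le> (\<Sum>S\<in>L. \<bar>fst S\<bar> + \<bar>snd S\<bar>)"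
    proof
      fix S assume "S \<in> L"
      then have "\<bar>fst S\<bar> + \<bar>snd S\<bar> \<le> (\<Sum>S\<in>L. \<bar>fst S\<bar> + \<bar>snd S\<bar>)"
        using assms by (intro member_le_sum) auto
      then show "\<bar>fst S\<bar> \<le> (\<Sum>S\<in>L. \<bar>fst S\<bar> + \<bar>snd S\<bar>) \<and> \<bar>snd S\<bar> \<le> (\<Sum>S\<in>L. \<bar>fst S\<bar> + \<bar>snd S\<bar>)"
        by linarith
    qed
  qed
  have "X \<subseteq> {-n..n} \<times> {-n..n}" if X: "hole_of L X" for X
  proof -
    have bound: "\<forall>x\<in>X. f x \<le> n"
      if "\<And>x. \<exists>t. plus_adj x t \<and> f x < f t" and fL: "\<And>S. S \<in> L \<Longrightarrow> f S \<le> n"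
      for f :: "sq \<Rightarrow> int"
    proof (rule hole_coordinate_bound)
      show "finite X"
        using X by (simp add: hole_of_def)
      fix x assume x: "x \<in> X" "n < f x"
      from that(1) obtain t where t: "plus_adj x t" "f x < f t"
        by blast
      have "t \<notin> L"
        using fL[of t] x t by auto
      with X x t show "\<exists>t\<in>X. f x < f t"
        unfolding hole_of_def by blast
    qed
    have n_bounds: "fst S \<le> n" "- fst S \<le> n" "snd S \<le> n" "- snd S \<le> n" if "S \<in> L" for S
      using bspec[OF n that] by linarith+
    have nbr: "plus_adj S (fst S + 1, snd S)" "plus_adj S (fst S - 1, snd S)"
      "plus_adj S (fst S, snd S + 1)" "plus_adj S (fst S, snd S - 1)" for S
      by (cases S; simp add: plus_adj_iff)+
    have "\<forall>x\<in>X. fst x \<le> n"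
    proof (rule bound)
      show "\<exists>t. plus_adj x t \<and> fst x < fst t" for x
        by (rule exI[of _ "(fst x + 1, snd x)"]) (simp add: nbr)
    qed (rule n_bounds)
    moreover have "\<forall>x\<in>X. - fst x \<le> n"
    proof (rule bound)
      show "\<exists>t. plus_adj x t \<and> - fst x < - fst t" for x
        by (rule exI[of _ "(fst x - 1, snd x)"]) (simp add: nbr)
    qed (rule n_bounds)
    moreover have "\<forall>x\<in>X. snd x \<le> n"
    proof (rule bound)
      show "\<exists>t. plus_adj x t \<and> snd x < snd t" for x
        by (rule exI[of _ "(fst x, snd x + 1)"]) (simp add: nbr)
    qed (rule n_bounds)
    moreover have "\<forall>x\<in>X. - snd x \<le> n"
    proof (rule bound)
      show "\<exists>t. plus_adj x t \<and> - snd x < - snd t" for x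
        by (rule exI[of _ "(fst x, snd x - 1)"]) (simp add: nbr)
    qed (rule n_bounds)
    ultimately have "fst x \<le> n" "- fst x \<le> n" "snd x \<le> n" "- snd x \<le> n" if "x \<in> X" for x
      using that by blast+
    then show ?thesis
      by (auto simp: mem_Times_iff minus_le_iff simp del: split_paired_All)
  qed
  then have "fill L \<subseteq> L \<union> {-n..n} \<times> {-n..n}"
    unfolding fill_def by blast
  then show ?thesis
    by (rule finite_subset) (use assms in auto)
qed

lemma fill_mono:
  assumes "L \<subseteq> A"
  shows "fill L \<subseteq> fill A"
proof -
  have "X - A \<subseteq> fill A" if "hole_of L X" for X
  proof (rule hole_subset_fill)
    show "hole_of A (X - A)"
      using that assms unfolding hole_of_def by blast
  qed
  with assms show ?thesis
    unfolding fill_def[of L] using subset_fill[of A] by blast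
qed

text \<open>
  Together with \<^term>\<open>L \<subseteq> fill L\<close> and monotonicity this makes \<^const>\<open>fill\<close> a closure operator on
  finite sets; a hole of \<open>A\<close>, enlarged by all the cells that \<open>L\<close> encloses, is a hole of \<open>L\<close>.
\<close>

lemma fill_least:
  assumes "finite L" "A \<subseteq> fill L"
  shows "fill A \<subseteq> fill L"
proof -
  have "X \<subseteq> fill L" if "hole_of A X" for X
  proof -
    have "hole_of L (X \<union> fill L - L)"
      unfolding hole_of_def
    proof (intro conjI ballI allI impI)
      show "finite (X \<union> fill L - L)"
        using that finite_fill[OF assms(1)] by (simp add: hole_of_def)
      fix x t assume x: "x \<in> X \<union> fill L - L" and adj: "plus_adj x t"
      have "t \<in> X \<union> A" if "x \<in> X"
        using \<open>hole_of A X\<close> that adj unfolding hole_of_def by blast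
      moreover have "t \<in> fill L" if "x \<in> fill L"
        using fill_exit[OF that _ adj] x by blast
      ultimately show "t \<in> X \<union> fill L - L \<union> L"
        using x assms(2) by blast
    qed blast
    from hole_subset_fill[OF this] show ?thesis
      using subset_fill[of L] by auto
  qed
  with assms(2) show ?thesis
    unfolding fill_def[of A] by blast
qed

section \<open>Simple cycles and the cells they bound\<close>

text \<open>cycles\<close>

definition closed_path_edges :: "'a list \<Rightarrow> 'a set set" where
  "closed_path_edges vs = {{vs ! i, vs ! (Suc i mod length vs)} | i. i < length vs}"

text \<open>
  The first vertex of a longest path has a second edge, and by maximality that edge leads back to
  the path, where it closes a cycle.
\<close>

lemma min_degree_two_cycle:
  fixes E :: "'a set set"
  assumes fin: "finite (\<Union>E)" and loopfree: "\<And>v. {v} \<notin> E"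
    and ne: "{a, b} \<in> E"
    and deg: "\<And>v w. {v, w} \<in> E \<Longrightarrow> \<exists>w'. w' \<noteq> w \<and> {v, w'} \<in> E"
  obtains vs where "3 \<le> length vs" "distinct vs" "closed_path_edges vs \<subseteq> E"
proof -
  define P where "P ps \<longleftrightarrow> distinct ps \<and> 2 \<le> length ps \<and> set ps \<subseteq> \<Union>E \<and> successively (\<lambda>u v. {u, v} \<in> E) ps" for ps
  have "P [a, b]"
    using ne loopfree[of a] unfolding P_def by auto
  moreover have "\<forall>ps. P ps \<longrightarrow> length ps < Suc (card (\<Union>E))"
    using fin by (auto simp: P_def less_Suc_eq_le simp flip: distinct_card intro!: card_mono)
  ultimately obtain ps where ps: "P ps" and longest: "\<And>qs. P qs \<Longrightarrow> length qs \<le> length ps"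
    using ex_has_greatest_nat[of P "[a, b]" length "Suc (card (\<Union>E))"] by auto
  then obtain u v qs where ps_eq: "ps = u # v # qs"
    by (cases ps rule: list.exhaust[case_product list.exhaust[of "tl ps"]]) (auto simp: P_def)
  with ps have "{u, v} \<in> E"
    by (simp add: P_def)
  from deg[OF this] obtain w where w: "w \<noteq> v" "{u, w} \<in> E"
    by auto
  have "w \<in> set ps"
  proof (rule ccontr)
    assume "w \<notin> set ps"
    with ps w have "P (w # ps)"
      by (auto simp: P_def ps_eq insert_commute)
    with longest[of "w # ps"] show False
      by simp
  qed
  then obtain k where k: "k < length ps" "ps ! k = w"
    by (auto simp: in_set_conv_nth)
  (* The closing edge returns to a vertex that is neither u itself nor its successor v,
     so at least three vertices lie on the cycle. *)
  have "k \<noteq> 0"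
  proof
    assume "k = 0"
    with k have "w = u" by (simp add: ps_eq)
    with w loopfree[of u] show False by simp
  qed
  moreover have "k \<noteq> 1"
    using k w by (auto simp: ps_eq)
  ultimately have k2: "2 \<le> k"
    by simp
  define vs where "vs = take (Suc k) ps"
  have len: "length vs = Suc k"
    using k by (simp add: vs_def)
  have "closed_path_edges vs \<subseteq> E"
  proof
    fix e assume "e \<in> closed_path_edges vs"
    then obtain i where i: "i < Suc k" "e = {vs ! i, vs ! (Suc i mod Suc k)}"
      by (auto simp: closed_path_edges_def len)
    have nth: "vs ! l = ps ! l" if "l \<le> k" for l
      using that by (simp add: vs_def)
    show "e \<in> E"
    proof (cases "i = k")
      case True
      with i k have "e = {w, u}"
        by (simp add: nth ps_eq)
      with w show ?thesis
        by (simp add: insert_commute)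
    next
      case False
      with i have "i < k"
        by simp
      then have "e = {ps ! i, ps ! Suc i}"
        using i by (simp add: nth)
      moreover have "{ps ! i, ps ! Suc i} \<in> E"
        using ps \<open>i < k\<close> k by (auto simp: P_def successively_conv_nth)
      ultimately show ?thesis
        by simp
    qed
  qed
  with that[of vs] show thesis
    using k2 len ps by (simp add: vs_def P_def)
qed

lemma closed_path_neighbours:
  assumes "3 \<le> length vs" "distinct vs" "v \<in> set vs"
  obtains a b where "a \<noteq> b" "{w. {v, w} \<in> closed_path_edges vs} = {a, b}"
proof -
  define m where "m = length vs"
  obtain i where i: "i < m" "v = vs ! i"
    using assms(3) by (auto simp: in_set_conv_nth m_def)
  define s where "s k = Suc k mod m" for k
  define p where "p = (if i = 0 then m - 1 else i - 1)"
  have m: "3 \<le> m"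
    using assms(1) by (simp add: m_def)
  have s: "s k = (if Suc k = m then 0 else Suc k)" if "k < m" for k
    using that by (auto simp: s_def)
  have s_bound: "s k < m" if "k < m" for k
    using that by (auto simp: s_def)
  have p: "p < m" "s p = i"
    using i m by (auto simp: p_def s)
  have pred: "k = p" if "k < m" "s k = i" for k
    using that i m by (auto simp: s p_def split: if_splits)
  have nth_eq: "vs ! k = vs ! l \<longleftrightarrow> k = l" if "k < m" "l < m" for k l
    using that assms(2) by (simp add: nth_eq_iff_index_eq m_def)
  have "s i \<noteq> p"
    using i m by (auto simp: s p_def)
  then have "vs ! s i \<noteq> vs ! p"
    using nth_eq s_bound i p by auto
  moreover have "{w. {v, w} \<in> closed_path_edges vs} = {vs ! s i, vs ! p}"
  proof (intro set_eqI iffI)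
    fix w assume "w \<in> {w. {v, w} \<in> closed_path_edges vs}"
    then obtain k where k: "k < m" "{v, w} = {vs ! k, vs ! s k}"
      by (auto simp: closed_path_edges_def m_def s_def)
    then consider "v = vs ! k" "w = vs ! s k" | "v = vs ! s k" "w = vs ! k"
      by (auto simp: doubleton_eq_iff)
    then show "w \<in> {vs ! s i, vs ! p}"
    proof cases
      case 1
      then show ?thesis
        using nth_eq k i by auto
    next
      case 2
      then have "s k = i"
        using nth_eq s_bound k i by auto
      with 2 pred k show ?thesis
        by auto
    qed
  next
    fix w assume "w \<in> {vs ! s i, vs ! p}"
    moreover have "{v, vs ! s i} \<in> closed_path_edges vs"
      using i by (auto simp: closed_path_edges_def m_def s_def)
    moreover have "{v, vs ! p} \<in> closed_path_edges vs"
      using i p by (auto simp: closed_path_edges_def m_def s_def insert_commute intro!: exI[of _ p])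
    ultimately show "w \<in> {w. {v, w} \<in> closed_path_edges vs}"
      by auto
  qed
  ultimately show thesis
    using that by blast
qed

text \<open>
  Even degree at the vertex \<open>(i, j)\<close>: an even number of its four incident edges belong to \<open>B\<close>.
\<close>

definition even_at :: "sq set set \<Rightarrow> int \<Rightarrow> int \<Rightarrow> bool" where
  "even_at B i j \<longleftrightarrow>
     ((hedge (i, j) \<in> B) \<noteq> (hedge (i - 1, j) \<in> B)) = ((vedge (i, j) \<in> B) \<noteq> (vedge (i, j - 1) \<in> B))"

lemma even_at_cell_boundary: "even_at (cell_boundary X) i j"
  unfolding even_at_def hedge_in_cell_boundary vedge_in_cell_boundary by auto

lemma hedge_pair: "{(i, j), (i + 1, j)} = hedge (i, j)" "{(i, j), (i - 1, j)} = hedge (i - 1, j)"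
  and vedge_pair: "{(i, j), (i, j + 1)} = vedge (i, j)" "{(i, j), (i, j - 1)} = vedge (i, j - 1)"
  by (auto simp: hedge_def vedge_def)

lemma even_at_cycle:
  assumes "3 \<le> length vs" "distinct vs"
    and lattice: "closed_path_edges vs \<subseteq> range hedge \<union> range vedge"
  shows "even_at (closed_path_edges vs) i j"
proof -
  define B where "B = closed_path_edges vs"
  define N where "N = {w. {(i, j), w} \<in> B}"
  have N_sub: "N \<subseteq> {(i + 1, j), (i - 1, j), (i, j + 1), (i, j - 1)}"
  proof
    fix w assume "w \<in> N"
    then obtain v where "{(i, j), w} = hedge v \<or> {(i, j), w} = vedge v"
      using lattice unfolding N_def B_def by blast
    then show "w \<in> {(i + 1, j), (i - 1, j), (i, j + 1), (i, j - 1)}"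
      by (cases v; cases w) (auto simp: hedge_def vedge_def doubleton_eq_iff)
  qed
  have "even_at B i j \<longleftrightarrow>
     (((i + 1, j) \<in> N) \<noteq> ((i - 1, j) \<in> N)) = (((i, j + 1) \<in> N) \<noteq> ((i, j - 1) \<in> N))"
    unfolding even_at_def N_def by (simp add: hedge_pair vedge_pair)
  note even_iff = this
  consider "N = {}" | a b where "a \<noteq> b" "N = {a, b}"
  proof (cases "(i, j) \<in> set vs")
    case True
    then show ?thesis
      using closed_path_neighbours[OF assms(1,2)] that unfolding N_def B_def by metis
  next
    case False
    have "e \<subseteq> set vs" if "e \<in> B" for e
    proof -
      from that obtain k where "k < length vs" "e = {vs ! k, vs ! (Suc k mod length vs)}"
        by (auto simp: B_def closed_path_edges_def)
      moreover from this have "Suc k mod length vs < length vs"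
        by (intro mod_less_divisor) auto
      ultimately show ?thesis
        by auto
    qed
    then have "N = {}"
      using False by (auto simp: N_def)
    with that show ?thesis by blast
  qed
  then show ?thesis
  proof cases
    case 1
    then show ?thesis
      using even_iff by (simp add: B_def)
  next
    case (2 a b)
    have "a \<in> {(i + 1, j), (i - 1, j), (i, j + 1), (i, j - 1)}"
      "b \<in> {(i + 1, j), (i - 1, j), (i, j + 1), (i, j - 1)}"
      using N_sub 2 by auto
    with \<open>a \<noteq> b\<close> have "(((i + 1, j) \<in> N) \<noteq> ((i - 1, j) \<in> N)) = (((i, j + 1) \<in> N) \<noteq> ((i, j - 1) \<in> N))"
      unfolding 2(2) by auto
    then show ?thesis
      using even_iff by (simp add: B_def)
  qed
qed

text \<open>
  The cells that \<open>B\<close> encloses are those whose horizontal ray to the right crosses \<open>B\<close> an odd number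
  of times. Moving across a vertical edge changes the count by that edge; that a horizontal edge
  also separates exactly when it lies in \<open>B\<close> is propagated from the far right, column by column,
  by the even degrees.
\<close>

lemma even_edge_set_bounds:
  assumes fin: "finite B" and lattice: "B \<subseteq> range hedge \<union> range vedge"
    and even: "\<And>i j. even_at B i j"
  obtains X where "finite X" "cell_boundary X = B"
proof -
  define R where "R i j = {k. i < k \<and> vedge (k, j) \<in> B}" for i j
  define X where "X = {(i, j). odd (card (R i j))}"
  have inX: "(i, j) \<in> X \<longleftrightarrow> odd (card (R i j))" for i j
    by (simp add: X_def)
  have finR: "finite (R i j)" for i j
  proof -
    have "finite ((\<lambda>k. vedge (k, j)) -` B)"
      using fin by (intro finite_vimageI) (auto simp: inj_def)
    then show ?thesis
      by (rule rev_finite_subset) (auto simp: R_def)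
  qed
  have crossv: "((i, j) \<in> X) \<noteq> ((i - 1, j) \<in> X) \<longleftrightarrow> vedge (i, j) \<in> B" for i j
  proof -
    have "R (i - 1) j = (if vedge (i, j) \<in> B then insert i (R i j) else R i j)"
    proof -
      have "i - 1 < k \<longleftrightarrow> k = i \<or> i < k" for k :: int
        by arith
      then show ?thesis
        by (auto simp: R_def)
    qed
    moreover have "i \<notin> R i j"
      by (simp add: R_def)
    ultimately show ?thesis
      using finR[of i j] by (auto simp: inX)
  qed
  obtain n where n: "\<And>i j. hedge (i, j) \<in> B \<or> vedge (i, j) \<in> B \<Longrightarrow> \<bar>i\<bar> < n \<and> \<bar>j\<bar> < n"
  proof -
    define V where "V = {v. hedge v \<in> B \<or> vedge v \<in> B}"
    have "V = hedge -` B \<union> vedge -` B"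
      by (auto simp: V_def)
    then have "finite V"
      using fin by (auto intro!: finite_vimageI simp: inj_def)
    define n where "n = 1 + (\<Sum>v\<in>V. \<bar>fst v\<bar> + \<bar>snd v\<bar>)"
    have "\<bar>fst v\<bar> + \<bar>snd v\<bar> < n" if "v \<in> V" for v
    proof -
      have "\<bar>fst v\<bar> + \<bar>snd v\<bar> \<le> (\<Sum>v\<in>V. \<bar>fst v\<bar> + \<bar>snd v\<bar>)"
        using that \<open>finite V\<close> by (intro member_le_sum) auto
      then show ?thesis by (simp add: n_def)
    qed
    then have "\<bar>i\<bar> < n \<and> \<bar>j\<bar> < n" if "hedge (i, j) \<in> B \<or> vedge (i, j) \<in> B" for i j
      using that unfolding V_def by force
    with that show thesis by blast
  qed
  have right: "(i, j) \<notin> X" if "n \<le> i" for i j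
  proof -
    have "R i j = {}"
      using n that by (fastforce simp: R_def)
    then show ?thesis by (simp add: inX)
  qed
  (* Columns to the right of n see no edge of B; from there the claim moves left because
     the four edges at (i, j) have even parity. *)
  have crossh: "((i, j) \<in> X) \<noteq> ((i, j - 1) \<in> X) \<longleftrightarrow> hedge (i, j) \<in> B" for i j
  proof (cases "i \<le> n")
    case True
    then show ?thesis
    proof (induction i rule: int_le_induct)
      case base
      show ?case
        using right[of n] n[of n j] by auto
    next
      case (step i)
      with even[of i j] crossv[of i j] crossv[of i "j - 1"] show ?case
        unfolding even_at_def by auto
    qed
  next
    case False
    then show ?thesis
      using right[of i] n[of i j] by auto
  qed
  have hmem: "hedge (i, j) \<in> cell_boundary X \<longleftrightarrow> hedge (i, j) \<in> B" for i j
    unfolding hedge_in_cell_boundary by (rule crossh)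
  have vmem: "vedge (i, j) \<in> cell_boundary X \<longleftrightarrow> vedge (i, j) \<in> B" for i j
    unfolding vedge_in_cell_boundary by (rule crossv)
  have "cell_boundary X = B"
  proof (intro set_eqI iffI)
    fix e assume e: "e \<in> cell_boundary X"
    then show "e \<in> B"
      by (cases rule: cell_boundary_cases) (use e hmem vmem in auto)
  next
    fix e assume "e \<in> B"
    then obtain i j where "e = hedge (i, j) \<or> e = vedge (i, j)"
      using lattice by force
    with \<open>e \<in> B\<close> show "e \<in> cell_boundary X"
      using hmem vmem by auto
  qed
  moreover have "X \<subseteq> {-n..n} \<times> {-n..n}"
  proof -
    have far_row: "(i, j) \<notin> X" if "n \<le> \<bar>j\<bar>" for i j
    proof -
      have "R i j = {}"
        using n that by (fastforce simp: R_def)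
      then show ?thesis by (simp add: inX)
    qed
    (* To the left of all edges the membership in X no longer depends on the row either,
       and high rows contain no cell of X. *)
    have left: "(i, j) \<notin> X" if "i \<le> - n" for i j
    proof (cases "j \<le> n")
      case True
      then show ?thesis
      proof (induction j rule: int_le_induct)
        case base
        then show ?case using far_row[of n] by auto
      next
        case (step j)
        with crossh[of i j] n[of i j] that show ?case
          by auto
      qed
    next
      case False
      then show ?thesis using far_row[of j i] by auto
    qed
    have "- n \<le> i \<and> i \<le> n \<and> - n \<le> j \<and> j \<le> n" if "(i, j) \<in> X" for i j
    proof -
      have "\<not> n \<le> \<bar>j\<bar>" "\<not> i \<le> - n" "\<not> n \<le> i"
        using that far_row left right by blast+
      then show ?thesis
        by linarith
    qed
    then show ?thesis
      by auto
  qed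
  then have "finite X"
    by (rule finite_subset) auto
  ultimately show thesis
    using that by blast
qed

section \<open>The boundary of a filled plus-connected set\<close>

text \<open>
  Connectedness without paths: a subset of \<open>L\<close> that is closed under adjacency in \<open>L\<close> is empty or
  everything.
\<close>

definition plus_connected :: "sq set \<Rightarrow> bool" where
  "plus_connected L \<longleftrightarrow>
     (\<forall>X. (\<forall>s\<in>X \<inter> L. \<forall>t\<in>L. plus_adj s t \<longrightarrow> t \<in> X) \<longrightarrow> X \<inter> L \<noteq> {} \<longrightarrow> L \<subseteq> X)"

text \<open>
  No finite set has a boundary that is a proper nonempty part of the boundary of \<^term>\<open>fill L\<close>. Such
  a set \<open>X\<close> lies in \<^term>\<open>fill L\<close>, and no boundary edge separates it from the rest of \<^term>\<open>fill L\<close>, so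
  \<open>X\<close> and the rest are not adjacent. Where \<open>X\<close> borders on unfilled cells it contains a cell of \<open>L\<close>,
  hence all of \<open>L\<close>; the rest, which could be left only through \<open>L\<close>, is empty.
\<close>

lemma boundary_fill_minimal:
  assumes "plus_connected L" "finite L" "finite X"
    and sub: "cell_boundary X \<subseteq> cell_boundary (fill L)" and ne: "cell_boundary X \<noteq> {}"
  shows "X = fill L"
proof -
  (* The cells of X outside the filling would form another hole of L. *)
  have XF: "X \<subseteq> fill L"
  proof -
    have "hole_of L (X - fill L)"
      unfolding hole_of_def
    proof (intro conjI ballI allI impI)
      fix x t assume x: "x \<in> X - fill L" and adj: "plus_adj x t"
      show "t \<in> X - fill L \<union> L"
      proof (cases "t \<in> fill L")
        case True
        then show ?thesis
          using fill_exit[of t L x] x adj plus_adj_sym by auto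
      next
        case False
        have "t \<in> X"
        proof (rule ccontr)
          assume "t \<notin> X"
          with x adj obtain e where e: "e \<in> cell_boundary X" "e \<in> cell_edges x" "e \<in> cell_edges t"
            by (auto elim: cell_boundaryI)
          with sub cell_boundary_iff_plus_adj[OF adj, of e "fill L"] x False show False
            by auto
        qed
        with False show ?thesis by simp
      qed
    qed (use assms subset_fill in auto)
    from hole_subset_fill[OF this] show ?thesis by auto
  qed
  have exit: "t \<notin> fill L" if "x \<in> X" "t \<notin> X" "plus_adj x t" for x t
  proof -
    from that obtain e where e: "e \<in> cell_boundary X" "e \<in> cell_edges x" "e \<in> cell_edges t"
      by (auto elim: cell_boundaryI)
    with sub cell_boundary_iff_plus_adj[OF that(3), of e "fill L"] XF that show ?thesis
      by auto
  qed
  obtain e where "e \<in> cell_boundary X"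
    using ne by blast
  then obtain x t where xt: "x \<in> X" "t \<notin> X" "plus_adj x t"
    by (rule cell_boundaryE)
  then have "x \<in> L"
    using exit XF fill_exit[of x L t] by auto
  have "L \<subseteq> X"
  proof -
    have "\<forall>s\<in>X \<inter> L. \<forall>t\<in>L. plus_adj s t \<longrightarrow> t \<in> X"
      using exit subset_fill[of L] by blast
    then show ?thesis
      using assms(1) xt(1) \<open>x \<in> L\<close> unfolding plus_connected_def by blast
  qed
  (* The remainder could be left only through L, which is contained in X. *)
  have "fill L - X = {}"
  proof (rule finite_closed_set_empty)
    show "finite (fill L - X)"
      using finite_fill[OF assms(2)] by simp
    fix f t assume f: "f \<in> fill L - X" "plus_adj f t"
    then show "t \<in> fill L - X"
      using exit[of t f] fill_exit[of f L t] \<open>L \<subseteq> X\<close> plus_adj_sym by blast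
  qed
  with XF show ?thesis by auto
qed

lemma boundary_edge_continues:
  assumes "{v, w} \<in> cell_boundary X"
  shows "\<exists>w'. w' \<noteq> w \<and> {v, w'} \<in> cell_boundary X"
proof -
  obtain i j where v: "v = (i, j)"
    by (cases v)
  define P where "P u \<longleftrightarrow> {(i, j), u} \<in> cell_boundary X" for u
  define r l u d where nbrs: "r = (i + 1, j)" "l = (i - 1, j)" "u = (i, j + 1)" "d = (i, j - 1)"
  have "w \<in> {r, l, u, d}"
    using assms unfolding v nbrs
    by (cases rule: cell_boundary_cases; cases w)
      (auto simp: hedge_def vedge_def doubleton_eq_iff)
  moreover have "(P r \<noteq> P l) = (P u \<noteq> P d)"
    using even_at_cell_boundary[of X i j] unfolding even_at_def P_def nbrs hedge_pair vedge_pair .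
  moreover have "r \<noteq> l" "r \<noteq> u" "r \<noteq> d" "l \<noteq> u" "l \<noteq> d" "u \<noteq> d"
    by (simp_all add: nbrs)
  moreover have "P w"
    using assms by (simp add: P_def v)
  ultimately have "\<exists>w'. w' \<noteq> w \<and> P w'"
    by (elim insertE emptyE; metis)
  then show ?thesis
    by (simp add: P_def v)
qed

text \<open>
  The planar fact behind everything. Every vertex has even degree in the boundary, so the boundary
  contains a simple cycle; that cycle bounds a finite set of cells, which by minimality of the
  boundary is the whole filling.
\<close>

theorem boundary_fill_is_cycle:
  assumes "plus_connected L" "finite L" "L \<noteq> {}"
  obtains vs where "3 \<le> length vs" "distinct vs" "closed_path_edges vs = cell_boundary (fill L)"
proof -
  let ?E = "cell_boundary (fill L)"
  note lattice = cell_boundary_lattice[of "fill L"]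
  have finE: "finite ?E"
    by (simp add: finite_cell_boundary finite_fill assms)
  have "?E \<noteq> {}"
  proof
    assume "?E = {}"
    then have "fill L = {}"
      by (intro finite_closed_set_empty finite_fill assms) (metis cell_boundaryI empty_iff)
    with assms(3) subset_fill show False by auto
  qed
  then obtain e where "e \<in> ?E" by auto
  moreover from this obtain a b where "e = {a, b}"
    using lattice by (auto simp: hedge_def vedge_def)
  ultimately have "{a, b} \<in> ?E"
    by simp
  moreover have "finite (\<Union>?E)"
    using finE lattice by (auto simp: hedge_def vedge_def)
  moreover have "{v} \<notin> ?E" for v
    using lattice by (cases v) (auto simp: hedge_def vedge_def)
  ultimately obtain vs where vs: "3 \<le> length vs" "distinct vs" "closed_path_edges vs \<subseteq> ?E"
    using boundary_edge_continues by (metis min_degree_two_cycle)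
  obtain X where X: "finite X" "cell_boundary X = closed_path_edges vs"
  proof (rule even_edge_set_bounds)
    show "finite (closed_path_edges vs)"
      using vs(3) finE by (rule finite_subset)
    show "closed_path_edges vs \<subseteq> range hedge \<union> range vedge"
      using vs(3) lattice by auto
    then show "even_at (closed_path_edges vs) i j" for i j
      using vs by (intro even_at_cycle)
  qed
  have "closed_path_edges vs \<noteq> {}"
    using vs(1) by (force simp: closed_path_edges_def)
  with boundary_fill_minimal[OF assms(1,2) X(1)] X(2) vs have "X = fill L"
    by simp
  with X(2) vs that show thesis by metis
qed

section \<open>Inside and outside of lattice curves\<close>

definition segment :: "sq set \<Rightarrow> complex set" where
  "segment e = convex hull (lattice_point ` e)"

definition open_segment_of :: "sq set \<Rightarrow> complex set" where
  "open_segment_of e = segment e - lattice_point ` e"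

definition lattice_curve :: "sq set set \<Rightarrow> complex set" where
  "lattice_curve B = (\<Union>e\<in>B. segment e)"

definition center :: "sq \<Rightarrow> complex" where
  "center S = Complex (of_int (fst S)) (of_int (snd S))"

lemma curve_image: "curve ((`) lattice_point ` B) = lattice_curve B"
  by (simp add: curve_def lattice_curve_def segment_def)

lemma mem_square:
  "z \<in> square (i, j) \<longleftrightarrow> of_int i \<le> Re z + 1/2 \<and> Re z + 1/2 \<le> of_int i + 1 \<and>
     of_int j \<le> Im z + 1/2 \<and> Im z + 1/2 \<le> of_int j + 1"
  by (auto simp: square_def in_cbox_complex_iff)

lemma mem_interior_square:
  "z \<in> interior (square (i, j)) \<longleftrightarrow> of_int i < Re z + 1/2 \<and> Re z + 1/2 < of_int i + 1 \<and>
     of_int j < Im z + 1/2 \<and> Im z + 1/2 < of_int j + 1"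
  by (auto simp: square_def interior_cbox in_box_complex_iff)

lemma convex_square: "convex (square S)"
  by (simp add: square_def)

lemma center_in_interior: "center S \<in> interior (square S)"
  by (cases S) (simp add: mem_interior_square center_def)

lemma segment_hedge:
  "segment (hedge (i, j)) = {z. Im z + 1/2 = of_int j \<and> of_int i \<le> Re z + 1/2 \<and> Re z + 1/2 \<le> of_int i + 1}"
  unfolding segment_def hedge_def image_insert image_empty segment_convex_hull[symmetric]
  by (subst closed_segment_same_Im) (auto simp: lattice_point_def closed_segment_eq_real_ivl)

lemma segment_vedge:
  "segment (vedge (i, j)) = {z. Re z + 1/2 = of_int i \<and> of_int j \<le> Im z + 1/2 \<and> Im z + 1/2 \<le> of_int j + 1}"
  unfolding segment_def vedge_def image_insert image_empty segment_convex_hull[symmetric]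
  by (subst closed_segment_same_Re) (auto simp: lattice_point_def closed_segment_eq_real_ivl)

lemma open_segment_hedge:
  "open_segment_of (hedge (i, j)) =
     {z. Im z + 1/2 = of_int j \<and> of_int i < Re z + 1/2 \<and> Re z + 1/2 < of_int i + 1}"
  unfolding open_segment_of_def segment_hedge
  by (auto simp: hedge_def lattice_point_def complex_eq_iff)

lemma open_segment_vedge:
  "open_segment_of (vedge (i, j)) =
     {z. Re z + 1/2 = of_int i \<and> of_int j < Im z + 1/2 \<and> Im z + 1/2 < of_int j + 1}"
  unfolding open_segment_of_def segment_vedge
  by (auto simp: vedge_def lattice_point_def complex_eq_iff)

lemma unit_interval_unique:
  fixes x :: real
  assumes "of_int i < x" "x < of_int i + 1" "of_int k \<le> x" "x \<le> of_int k + 1"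
  shows "k = i"
proof -
  have "real_of_int i < of_int (k + 1)" "real_of_int k < of_int (i + 1)"
    using assms by simp_all
  then show ?thesis
    unfolding of_int_less_iff by simp
qed

lemma no_integer_inside:
  fixes x :: real
  assumes "of_int i < x" "x < of_int i + 1"
  shows "x \<noteq> of_int k"
  using unit_interval_unique[OF assms, of k] unit_interval_unique[OF assms, of "k - 1"] by auto

lemma lattice_edge_cases:
  assumes "e \<in> range hedge \<union> range vedge"
  obtains i j where "e = hedge (i, j)" | i j where "e = vedge (i, j)"
  using assms that by (metis UnE rangeE surj_pair)

lemma open_segment_unique:
  assumes p: "p \<in> open_segment_of e" "p \<in> segment e'"
    and lattice: "e \<in> range hedge \<union> range vedge" "e' \<in> range hedge \<union> range vedge"
  shows "e = e'"
  using lattice(1)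
proof (cases rule: lattice_edge_cases)
  case e: (1 i j)
  show ?thesis
    using lattice(2)
  proof (cases rule: lattice_edge_cases)
    case (1 k l)
    with p e show ?thesis
      using unit_interval_unique[of i "Re p + 1/2" k] by (simp add: open_segment_hedge segment_hedge)
  next
    case (2 k l)
    with p e show ?thesis
      using no_integer_inside[of i "Re p + 1/2" k] by (simp add: open_segment_hedge segment_vedge)
  qed
next
  case e: (2 i j)
  show ?thesis
    using lattice(2)
  proof (cases rule: lattice_edge_cases)
    case (1 k l)
    with p e show ?thesis
      using no_integer_inside[of j "Im p + 1/2" l] by (simp add: open_segment_vedge segment_hedge)
  next
    case (2 k l)
    with p e show ?thesis
      using unit_interval_unique[of j "Im p + 1/2" l] by (simp add: open_segment_vedge segment_vedge)
  qed
qed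

lemma interior_square_disjoint_segment:
  assumes p: "p \<in> interior (square S)" and lattice: "e \<in> range hedge \<union> range vedge"
  shows "p \<notin> segment e"
proof -
  obtain i j where S: "S = (i, j)"
    by (cases S)
  show ?thesis
    using lattice
  proof (cases rule: lattice_edge_cases)
    case (1 k l)
    then show ?thesis
      using p no_integer_inside[of j "Im p + 1/2" l] by (simp add: S mem_interior_square segment_hedge)
  next
    case (2 k l)
    then show ?thesis
      using p no_integer_inside[of i "Re p + 1/2" k] by (simp add: S mem_interior_square segment_vedge)
  qed
qed

lemma cell_edges_lattice: "cell_edges S \<subseteq> range hedge \<union> range vedge"
  by (auto elim: cell_edges_cases)

lemma segment_subset_square:
  assumes "e \<in> cell_edges S"
  shows "segment e \<subseteq> square S"
  using assms by (cases S) (auto simp: cell_edges_def segment_hedge segment_vedge mem_square)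

lemma open_segment_nonempty:
  assumes "e \<in> range hedge \<union> range vedge"
  obtains p where "p \<in> open_segment_of e"
  using assms
proof (cases rule: lattice_edge_cases)
  case (1 i j)
  then have "Complex (of_int i) (of_int j - 1/2) \<in> open_segment_of e"
    by (simp add: open_segment_hedge)
  with that show thesis by blast
next
  case (2 i j)
  then have "Complex (of_int i - 1/2) (of_int j) \<in> open_segment_of e"
    by (simp add: open_segment_vedge)
  with that show thesis by blast
qed

text \<open>
  The segment from the centre to the point runs through the open square, which no lattice edge
  enters.
\<close>

lemma square_point_connected_to_center:
  assumes B: "B \<subseteq> range hedge \<union> range vedge"
    and p: "p \<in> square S" "p \<notin> lattice_curve B"
  shows "connected_component (- lattice_curve B) (center S) p"
proof -
  have disj: "interior (square S) \<subseteq> - lattice_curve B"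
  proof
    fix q assume q: "q \<in> interior (square S)"
    have "q \<notin> segment e" if "e \<in> B" for e
      using interior_square_disjoint_segment[OF q] B that by blast
    then show "q \<in> - lattice_curve B"
      by (simp add: lattice_curve_def)
  qed
  have "open_segment (center S) p \<subseteq> interior (square S)"
    using p(1) closure_subset[of "square S"]
    by (intro in_interior_closure_convex_segment convex_square center_in_interior) blast
  then have "closed_segment (center S) p \<subseteq> - lattice_curve B"
    using disj center_in_interior[of S] p(2) unfolding closed_segment_eq_open by blast
  then show ?thesis
    unfolding connected_component_def
    by (intro exI[of _ "closed_segment (center S) p"]) simp
qed

text \<open>
  If the centre of \<open>u\<close> were in a bounded component of the complement of the curve, the squares with
  their centres in that component would be finite in number, and by crossing edges that belong to
  no square of \<open>L\<close> one would never leave them. They would form a hole of \<open>L\<close> that contains \<open>u\<close>.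
\<close>

lemma outside_of_unfilled:
  assumes B: "B \<subseteq> (\<Union>S\<in>L. cell_edges S)" and u: "u \<notin> fill L" "finite L"
  shows "center u \<in> outside (lattice_curve B)"
proof (rule ccontr)
  assume notout: "center u \<notin> outside (lattice_curve B)"
  have lattice: "B \<subseteq> range hedge \<union> range vedge"
    using B cell_edges_lattice by blast
  define D where "D = connected_component_set (- lattice_curve B) (center u)"
  have "center u \<notin> lattice_curve B"
    using interior_square_disjoint_segment[OF center_in_interior[of u]] lattice
    unfolding lattice_curve_def by blast
  then have "center u \<in> D" and "bounded D"
    using notout by (auto simp: outside_def D_def)
  define Y where "Y = {T. center T \<in> D} - L"
  have "finite {T. center T \<in> D}"
  proof -
    obtain r where r: "\<And>z. z \<in> D \<Longrightarrow> norm z \<le> r"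
      using \<open>bounded D\<close> by (auto simp: bounded_iff)
    have "{T. center T \<in> D} \<subseteq> {-\<lceil>r\<rceil>..\<lceil>r\<rceil>} \<times> {-\<lceil>r\<rceil>..\<lceil>r\<rceil>}"
    proof clarsimp
      fix i j assume "center (i, j) \<in> D"
      then have "norm (center (i, j)) \<le> r"
        by (rule r)
      with abs_Re_le_cmod[of "center (i, j)"] abs_Im_le_cmod[of "center (i, j)"]
      have "\<bar>real_of_int i\<bar> \<le> r" "\<bar>real_of_int j\<bar> \<le> r"
        by (auto simp: center_def)
      then show "- \<lceil>r\<rceil> \<le> i \<and> i \<le> \<lceil>r\<rceil> \<and> - \<lceil>r\<rceil> \<le> j \<and> j \<le> \<lceil>r\<rceil>"
        by linarith
    qed
    then show ?thesis
      by (rule finite_subset) simp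
  qed
  moreover have "t \<in> Y \<union> L" if x: "x \<in> Y" and adj: "plus_adj x t" for x t
  proof (cases "t \<in> L")
    case False
    obtain e where e: "e \<in> cell_edges x" "e \<in> cell_edges t"
      using adj by (auto simp: plus_adj_eq)
    have e_lattice: "e \<in> range hedge \<union> range vedge"
      using e cell_edges_lattice by blast
    (* A lattice edge has only the two squares x and t beside it, and neither is in L. *)
    have "e \<notin> B"
    proof
      assume "e \<in> B"
      then obtain S where S: "S \<in> L" "e \<in> cell_edges S"
        using B by auto
      have "S \<in> {x, t}"
        using e(1)
      proof (cases rule: cell_edges_cases)
        case (1 i j)
        then show ?thesis
          using e S adj by (auto simp: hedge_in_cell_edges plus_adj_def)
      next
        case (2 i j)
        then show ?thesis
          using e S adj by (auto simp: vedge_in_cell_edges plus_adj_def)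
      qed
      with S x False show False
        by (auto simp: Y_def)
    qed
    obtain p where p: "p \<in> open_segment_of e"
      using open_segment_nonempty[OF e_lattice] .
    then have "p \<notin> lattice_curve B"
      using \<open>e \<notin> B\<close> open_segment_unique[OF p _ e_lattice] lattice by (auto simp: lattice_curve_def)
    moreover have "p \<in> square x" "p \<in> square t"
      using p e segment_subset_square unfolding open_segment_of_def by blast+
    ultimately have "connected_component (- lattice_curve B) (center x) p"
      "connected_component (- lattice_curve B) (center t) p"
      using square_point_connected_to_center[OF lattice] by blast+
    then have "connected_component (- lattice_curve B) (center x) (center t)"
      by (meson connected_component_sym connected_component_trans)
    with x False show ?thesis
      by (auto simp: Y_def D_def intro: connected_component_trans)
  qed simp
  ultimately have "hole_of L Y"
    by (auto simp: hole_of_def Y_def)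
  then have "Y \<subseteq> fill L"
    by (rule hole_subset_fill)
  with \<open>center u \<in> D\<close> u(1) subset_fill show False
    by (auto simp: Y_def)
qed

text \<open>
  Unit intervals with integer endpoints that come close enough to \<open>x\<close> contain \<open>x\<close>.
\<close>

lemma floor_of_nearby:
  fixes x :: real
  obtains \<epsilon> where "\<epsilon> > 0"
    "\<And>y. \<bar>y - x\<bar> < \<epsilon> \<Longrightarrow> of_int \<lfloor>y\<rfloor> \<le> x \<and> x \<le> of_int \<lfloor>y\<rfloor> + 1"
proof
  (* The distance from x to the nearest integer other than x. *)
  let ?\<epsilon> = "min (x - (of_int \<lceil>x\<rceil> - 1)) (of_int \<lfloor>x\<rfloor> + 1 - x)"
  show "?\<epsilon> > 0"
    by (simp add: algebra_simps) linarith
  show "of_int \<lfloor>y\<rfloor> \<le> x \<and> x \<le> of_int \<lfloor>y\<rfloor> + 1" if "\<bar>y - x\<bar> < ?\<epsilon>" for y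
  proof -
    have "y < of_int (\<lfloor>x\<rfloor> + 1)" "of_int (\<lceil>x\<rceil> - 1) < y"
      using that by auto
    then have "\<lfloor>y\<rfloor> \<le> \<lfloor>x\<rfloor>" "\<lceil>x\<rceil> - 1 \<le> \<lfloor>y\<rfloor>"
      by linarith+
    then show ?thesis
      by linarith
  qed
qed

text \<open>
  The squares around a point are reached from each other through edges containing the point, and
  none of these edges is a boundary edge.
\<close>

lemma squares_at_point:
  assumes off: "p \<notin> lattice_curve (cell_boundary F)"
    and "(i, j) \<in> F" "p \<in> square (i, j)" "p \<in> square (k, l)"
  shows "(k, l) \<in> F"
proof -
  have horizontal: "(a, c) \<in> F \<longleftrightarrow> (a + 1, c) \<in> F"
    if "p \<in> square (a, c)" "p \<in> square (a + 1, c)" for a c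
  proof -
    have "p \<in> segment (vedge (a + 1, c))"
      using that by (auto simp: mem_square segment_vedge)
    with off have "vedge (a + 1, c) \<notin> cell_boundary F"
      by (auto simp: lattice_curve_def)
    then show ?thesis
      by (simp add: vedge_in_cell_boundary)
  qed
  have vertical: "(a, c) \<in> F \<longleftrightarrow> (a, c + 1) \<in> F"
    if "p \<in> square (a, c)" "p \<in> square (a, c + 1)" for a c
  proof -
    have "p \<in> segment (hedge (a, c + 1))"
      using that by (auto simp: mem_square segment_hedge)
    with off have "hedge (a, c + 1) \<notin> cell_boundary F"
      by (auto simp: lattice_curve_def)
    then show ?thesis
      by (simp add: hedge_in_cell_boundary)
  qed
  have near: "k = i \<or> k = i + 1 \<or> i = k + 1"
    if "of_int i \<le> x" "x \<le> of_int i + 1" "of_int k \<le> x" "x \<le> of_int k + 1" for i k and x :: real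
  proof -
    have "real_of_int i \<le> of_int (k + 1)" "real_of_int k \<le> of_int (i + 1)"
      using that by simp_all
    then show ?thesis
      unfolding of_int_le_iff by linarith
  qed
  have p: "p \<in> square (k, j)"
    using assms by (simp add: mem_square)
  have "k = i \<or> k = i + 1 \<or> i = k + 1"
    using assms(3,4) by (intro near[of i "Re p + 1/2" k]) (simp_all add: mem_square)
  then have "(k, j) \<in> F"
    using horizontal[of i j] horizontal[of k j] p assms(2,3) by auto
  moreover have "l = j \<or> l = j + 1 \<or> j = l + 1"
    using assms(3,4) by (intro near[of j "Im p + 1/2" l]) (simp_all add: mem_square)
  ultimately show ?thesis
    using vertical[of k j] vertical[of k l] p assms(4) by auto
qed

text \<open>
  Off the boundary curve, the union of the squares of \<open>F\<close> is open as well as closed, so a component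
  of the complement of the curve that meets it stays in this bounded set.
\<close>

lemma squares_subset_inside:
  assumes "finite F"
  shows "(\<Union>S\<in>F. square S) - lattice_curve (cell_boundary F) \<subseteq> inside (lattice_curve (cell_boundary F))"
proof
  define K where "K = (\<Union>S\<in>F. square S)"
  define \<Gamma> where "\<Gamma> = lattice_curve (cell_boundary F)"
  have interior: "p \<in> interior K" if p: "p \<in> K" "p \<notin> \<Gamma>" for p
  proof -
    obtain i j where ij: "(i, j) \<in> F" "p \<in> square (i, j)"
      using p by (auto simp: K_def)
    obtain \<delta> where \<delta>: "\<delta> > 0" "\<And>y. \<bar>y - (Re p + 1/2)\<bar> < \<delta> \<Longrightarrow>
        of_int \<lfloor>y\<rfloor> \<le> Re p + 1/2 \<and> Re p + 1/2 \<le> of_int \<lfloor>y\<rfloor> + 1"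
      using floor_of_nearby by blast
    obtain \<epsilon> where \<epsilon>: "\<epsilon> > 0" "\<And>y. \<bar>y - (Im p + 1/2)\<bar> < \<epsilon> \<Longrightarrow>
        of_int \<lfloor>y\<rfloor> \<le> Im p + 1/2 \<and> Im p + 1/2 \<le> of_int \<lfloor>y\<rfloor> + 1"
      using floor_of_nearby by blast
    have "ball p (min \<delta> \<epsilon>) \<subseteq> K"
    proof
      fix q assume "q \<in> ball p (min \<delta> \<epsilon>)"
      then have "norm (q - p) < \<delta>" "norm (q - p) < \<epsilon>"
        by (auto simp: dist_norm norm_minus_commute)
      then have "\<bar>Re q - Re p\<bar> < \<delta>" "\<bar>Im q - Im p\<bar> < \<epsilon>"
        using abs_Re_le_cmod[of "q - p"] abs_Im_le_cmod[of "q - p"] by auto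
      then have "p \<in> square (\<lfloor>Re q + 1/2\<rfloor>, \<lfloor>Im q + 1/2\<rfloor>)"
        using \<delta>(2)[of "Re q + 1/2"] \<epsilon>(2)[of "Im q + 1/2"] by (simp add: mem_square)
      then have "(\<lfloor>Re q + 1/2\<rfloor>, \<lfloor>Im q + 1/2\<rfloor>) \<in> F"
        using squares_at_point[of p F i j] ij p by (simp add: \<Gamma>_def)
      moreover have "q \<in> square (\<lfloor>Re q + 1/2\<rfloor>, \<lfloor>Im q + 1/2\<rfloor>)"
        unfolding mem_square by linarith
      ultimately show "q \<in> K"
        by (auto simp: K_def)
    qed
    then show ?thesis
      using \<delta>(1) \<epsilon>(1) by (metis centre_in_ball min_less_iff_conj mem_interior)
  qed
  have frontier: "frontier K \<subseteq> \<Gamma>"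
  proof -
    have "closed K"
      unfolding K_def using assms by (intro closed_UN) (auto simp: square_def)
    then show ?thesis
      using interior by (auto simp: frontier_def)
  qed
  have "bounded K"
    unfolding K_def using assms by (intro bounded_UN) (auto simp: square_def)
  fix p assume "p \<in> (\<Union>S\<in>F. square S) - lattice_curve (cell_boundary F)"
  then have p: "p \<in> K" "p \<notin> \<Gamma>"
    by (auto simp: K_def \<Gamma>_def)
  define D where "D = connected_component_set (- \<Gamma>) p"
  have "D \<subseteq> K"
  proof (rule ccontr)
    assume "\<not> D \<subseteq> K"
    moreover have "p \<in> D \<inter> K"
      using p by (simp add: D_def)
    moreover have "connected D"
      by (simp add: D_def)
    ultimately have "D \<inter> frontier K \<noteq> {}"
      by (intro connected_Int_frontier) blast+
    moreover have "D \<subseteq> - \<Gamma>"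
      by (simp add: D_def connected_component_subset)
    ultimately show False
      using frontier by auto
  qed
  with \<open>bounded K\<close> have "bounded D"
    by (auto intro: bounded_subset)
  with p show "p \<in> inside (lattice_curve (cell_boundary F))"
    by (simp add: inside_def D_def \<Gamma>_def)
qed

section \<open>The outermost boundary\<close>

lemma graph_edges_eq: "graph_edges L = (`) lattice_point ` (\<Union>S\<in>L. cell_edges S)"
  unfolding graph_edges_def edges_eq by blast

lemma cycle_edges_map: "cycle_edges (map lattice_point vs) = (`) lattice_point ` closed_path_edges vs"
proof -
  have "{map lattice_point vs ! i, map lattice_point vs ! (Suc i mod length (map lattice_point vs))} =
      lattice_point ` {vs ! i, vs ! (Suc i mod length vs)}" if "i < length vs" for i
  proof -
    have "Suc i mod length vs < length vs"
      using that by (intro mod_less_divisor) auto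
    with that show ?thesis
      by (simp only: nth_map length_map image_insert image_empty)
  qed
  then show ?thesis
    unfolding cycle_edges_def closed_path_edges_def setcompr_eq_image image_image
    by (intro image_cong) simp_all
qed

lemma lattice_image_mem_iff [simp]: "lattice_point ` e \<in> (`) lattice_point ` B \<longleftrightarrow> e \<in> B"
  by (rule inj_image_mem_iff[OF inj_image_lattice_point])

lemma boundary_fill_subset_graph: "cell_boundary (fill L) \<subseteq> (\<Union>S\<in>L. cell_edges S)"
proof
  fix e assume "e \<in> cell_boundary (fill L)"
  then obtain S T where "S \<in> fill L" "T \<notin> fill L" "plus_adj S T" "e \<in> cell_edges S"
    by (rule cell_boundaryE)
  with fill_exit[of S L T] show "e \<in> (\<Union>S\<in>L. cell_edges S)"
    by blast
qed

text \<open>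
  A boundary edge borders an unfilled square, whose centre is outside every cycle of the graph; a
  cycle that does not use the edge leaves its open segment connected to that centre.
\<close>

lemma boundary_fill_outermost:
  assumes L: "finite L" and e: "e \<in> cell_boundary (fill L)"
  shows "lattice_point ` e \<in> outermost_boundary L"
  unfolding outermost_boundary_def
proof (intro CollectI conjI allI impI)
  show "lattice_point ` e \<in> graph_edges L"
    using e boundary_fill_subset_graph unfolding graph_edges_eq by blast
  fix vs assume cycle: "graph_cycle L vs"
  define B where "B = {b \<in> (\<Union>S\<in>L. cell_edges S). lattice_point ` b \<in> cycle_edges vs}"
  have B: "cycle_edges vs = (`) lattice_point ` B"
    using cycle unfolding graph_cycle_def graph_edges_eq B_def by blast
  have B_sub: "B \<subseteq> (\<Union>S\<in>L. cell_edges S)"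
    by (auto simp: B_def)
  then have lattice: "B \<subseteq> range hedge \<union> range vedge"
    using cell_edges_lattice by blast
  obtain T where T: "T \<notin> fill L" "e \<in> cell_edges T"
    using e by (rule cell_boundaryE)
  show "lattice_point ` e \<in> cycle_edges vs \<or>
      convex hull (lattice_point ` e) - lattice_point ` e \<subseteq> outside (curve (cycle_edges vs))"
  proof (cases "e \<in> B")
    case True
    then show ?thesis by (simp add: B)
  next
    case False
    have "p \<in> outside (lattice_curve B)" if p: "p \<in> open_segment_of e" for p
    proof -
      have "p \<notin> segment b" if "b \<in> B" for b
        using open_segment_unique[OF p, of b] cell_edges_lattice[of T] T(2) lattice that False by blast
      then have "p \<notin> lattice_curve B"
        by (simp add: lattice_curve_def)
      moreover have "p \<in> square T"
        using p segment_subset_square[OF T(2)] unfolding open_segment_of_def by blast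
      ultimately show ?thesis
        using square_point_connected_to_center[OF lattice] outside_of_unfilled[OF B_sub T(1) L]
        by (blast intro: outside_same_component)
    qed
    then show ?thesis
      unfolding B curve_image open_segment_of_def segment_def by blast
  qed
qed

lemma filled_square_inside:
  assumes "finite L" "S \<in> fill L" "p \<in> square S" "p \<notin> lattice_curve (cell_boundary (fill L))"
  shows "p \<in> inside (lattice_curve (cell_boundary (fill L)))"
  by (rule subsetD[OF squares_subset_inside[OF finite_fill[OF assms(1)]]]) (use assms(2-4) in blast)

text \<open>
  The boundary of the filling is itself a cycle of the graph. An edge of \<open>L\<close> that is not on it belongs
  to a filled square and runs inside this cycle, so it is not outermost.
\<close>

theorem outermost_boundary_is_cycle:
  assumes L: "plus_connected L" "finite L" "L \<noteq> {}"
  shows "outermost_boundary L = (`) lattice_point ` cell_boundary (fill L)"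
    and "\<exists>vs. graph_cycle L vs \<and> outermost_boundary L = cycle_edges vs"
proof -
  let ?B = "cell_boundary (fill L)"
  obtain vs where vs: "3 \<le> length vs" "distinct vs" "closed_path_edges vs = ?B"
    using boundary_fill_is_cycle[OF L] .
  have edges: "cycle_edges (map lattice_point vs) = (`) lattice_point ` ?B"
    by (simp add: cycle_edges_map vs)
  have cycle: "graph_cycle L (map lattice_point vs)"
    unfolding graph_cycle_def edges graph_edges_eq
    using vs boundary_fill_subset_graph[of L]
    by (auto simp: distinct_map intro: inj_on_subset[OF inj_lattice_point])
  show eq: "outermost_boundary L = (`) lattice_point ` ?B"
  proof (intro equalityI subsetI)
    fix e assume e: "e \<in> outermost_boundary L"
    then obtain e' S where S: "S \<in> L" "e' \<in> cell_edges S" "e = lattice_point ` e'"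
      unfolding outermost_boundary_def graph_edges_eq by blast
    have lattice: "e' \<in> range hedge \<union> range vedge"
      using S cell_edges_lattice by blast
    show "e \<in> (`) lattice_point ` ?B"
    proof (rule ccontr)
      assume notin: "e \<notin> (`) lattice_point ` ?B"
      then have sub: "open_segment_of e' \<subseteq> outside (lattice_curve ?B)"
        using e cycle
        unfolding outermost_boundary_def edges[symmetric] curve_image[symmetric] open_segment_of_def
          segment_def S(3) by blast
      obtain p where p: "p \<in> open_segment_of e'"
        using open_segment_nonempty[OF lattice] .
      have "p \<notin> segment b" if "b \<in> ?B" for b
        using open_segment_unique[OF p _ lattice, of b] cell_boundary_lattice that notin S(3) by blast
      then have "p \<notin> lattice_curve ?B"
        by (simp add: lattice_curve_def)
      moreover have "p \<in> square S"
        using p segment_subset_square[OF S(2)] unfolding open_segment_of_def by blast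
      ultimately have "p \<in> inside (lattice_curve ?B)"
        using filled_square_inside[OF L(2)] S(1) subset_fill[of L] by blast
      with p sub inside_Int_outside[of "lattice_curve ?B"] show False
        by blast
    qed
  next
    fix e assume "e \<in> (`) lattice_point ` ?B"
    then show "e \<in> outermost_boundary L"
      using boundary_fill_outermost[OF L(2)] by blast
  qed
  show "\<exists>vs. graph_cycle L vs \<and> outermost_boundary L = cycle_edges vs"
    using cycle edges eq by metis
qed

text \<open>
  This turns the topological containment condition on an enclosing cycle into a condition on
  fillings: a filled square meets the boundary curve at most in its border, and an unfilled one has
  its centre outside the curve.
\<close>

lemma interior_inside_iff_filled:
  assumes L: "plus_connected L" "finite L" "L \<noteq> {}"
  shows "interior (square S) \<subseteq> inside (curve (outermost_boundary L)) \<longleftrightarrow> S \<in> fill L"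
proof -
  let ?B = "cell_boundary (fill L)"
  have off: "p \<notin> lattice_curve ?B" if p: "p \<in> interior (square S)" for p
  proof -
    have "p \<notin> segment e" if "e \<in> ?B" for e
      using interior_square_disjoint_segment[OF p, of e] cell_boundary_lattice[of "fill L"] that by blast
    then show ?thesis
      by (simp add: lattice_curve_def)
  qed
  show ?thesis
    unfolding outermost_boundary_is_cycle(1)[OF L] curve_image
  proof
    assume "S \<in> fill L"
    then show "interior (square S) \<subseteq> inside (lattice_curve ?B)"
      using filled_square_inside[OF L(2), of S] off interior_subset[of "square S"] by blast
  next
    assume inside: "interior (square S) \<subseteq> inside (lattice_curve ?B)"
    show "S \<in> fill L"
    proof (rule ccontr)
      assume "S \<notin> fill L"
      from outside_of_unfilled[OF boundary_fill_subset_graph this L(2)]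
      show False
        using inside center_in_interior[of S] inside_Int_outside[of "lattice_curve ?B"] by blast
    qed
  qed
qed

text \<open>
  Since a step out of the filling starts in \<open>L\<close>, the bordering squares depend on \<^term>\<open>fill L\<close> only.
\<close>

lemma bordering_squares_eq:
  assumes L: "plus_connected L" "finite L" "L \<noteq> {}"
  shows "bordering_squares L = {S \<in> fill L. cell_edges S \<inter> cell_boundary (fill L) \<noteq> {}}"
proof -
  have "edges S \<inter> outermost_boundary L \<noteq> {} \<longleftrightarrow> cell_edges S \<inter> cell_boundary (fill L) \<noteq> {}" for S
    unfolding outermost_boundary_is_cycle(1)[OF L] edges_eq
      image_Int[OF inj_image_lattice_point, symmetric] by simp
  moreover have "S \<in> L" if S: "S \<in> fill L" "e \<in> cell_edges S" "e \<in> cell_boundary (fill L)" for S e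
  proof -
    obtain T where T: "T \<notin> fill L" "e \<in> cell_edges T"
      using S(3) by (rule cell_boundaryE)
    have "S \<noteq> T"
      using S(1) T(1) by blast
    then have "plus_adj S T"
      using S(2) T(2) unfolding plus_adj_eq by blast
    with S(1) T(1) show "S \<in> L"
      by (rule fill_exit)
  qed
  ultimately show ?thesis
    using subset_fill[of L] unfolding bordering_squares_def disjoint_iff by (intro set_eqI) blast
qed

section \<open>The star-connected component of the origin\<close>

text \<open>
  Along a path for a symmetric relation, membership in a set closed under the relation spreads in
  both directions.
\<close>

lemma successively_closed:
  assumes "successively R xs" "\<And>x y. R x y \<Longrightarrow> R y x" "set xs \<inter> Q \<noteq> {}"
    and "\<And>x y. x \<in> Q \<Longrightarrow> x \<in> set xs \<Longrightarrow> y \<in> set xs \<Longrightarrow> R x y \<Longrightarrow> y \<in> Q"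
  shows "set xs \<subseteq> Q"
  using assms(1,3,4)
proof (induction xs rule: induct_list012)
  case (3 x y zs)
  have R: "R x y" "R y x"
    using 3(3) assms(2) by auto
  have "y \<in> Q"
  proof (cases "x \<in> Q")
    case True
    then show ?thesis
      using 3(5)[of x y] R by simp
  next
    case False
    with 3(4) have "set (y # zs) \<inter> Q \<noteq> {}"
      by auto
    then have "set (y # zs) \<subseteq> Q"
      using 3(3,5) by (intro 3(2)) auto
    then show ?thesis by simp
  qed
  moreover have "set (y # zs) \<subseteq> Q"
    using 3(3,5) \<open>y \<in> Q\<close> by (intro 3(2)) auto
  moreover have "x \<in> Q"
    using 3(5)[of y x] R \<open>y \<in> Q\<close> by simp
  ultimately show ?case by simp
qed auto

lemma plus_connected_plus_S_cycle:
  assumes "plus_S_cycle ss"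
  shows "plus_connected (set ss)"
  unfolding plus_connected_def
proof (intro allI impI)
  fix X assume "\<forall>s\<in>X \<inter> set ss. \<forall>t\<in>set ss. plus_adj s t \<longrightarrow> t \<in> X" "X \<inter> set ss \<noteq> {}"
  then show "set ss \<subseteq> X"
    using assms plus_adj_sym
    by (intro successively_closed[of plus_adj]) (auto simp: plus_S_cycle_def plus_S_path_def simp del: split_paired_All)
qed

lemma origin_in_component: "(0, 0) \<in> occ \<Longrightarrow> (0, 0) \<in> origin_component occ"
  unfolding origin_component_def by (intro CollectI exI[of _ "[(0, 0)]"]) simp

text \<open>
  Every initial segment of the path is a path to its own last square.
\<close>

lemma path_in_component:
  assumes "ss \<noteq> []" "hd ss = (0, 0)" "distinct ss" "set ss \<subseteq> occ" "successively star_adj ss"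
  shows "set ss \<subseteq> origin_component occ"
proof
  fix T assume "T \<in> set ss"
  then obtain xs ys where ss: "ss = xs @ T # ys"
    by (auto simp: in_set_conv_decomp)
  have "successively star_adj (xs @ [T])"
    using assms(5) unfolding ss by (auto simp: successively_append_iff)
  moreover have "hd (xs @ [T]) = (0, 0)"
    using assms(2) unfolding ss by (cases xs) auto
  ultimately show "T \<in> origin_component occ"
    using assms(3,4) unfolding origin_component_def ss
    by (intro CollectI exI[of _ "xs @ [T]"]) auto
qed

lemma origin_component_closed:
  assumes "S \<in> origin_component occ" "star_adj S T" "T \<in> occ"
  shows "T \<in> origin_component occ"
proof -
  obtain ss where ss: "ss \<noteq> []" "hd ss = (0, 0)" "last ss = S" "distinct ss" "set ss \<subseteq> occ"
    "successively star_adj ss"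
    using assms(1) unfolding origin_component_def by blast
  (* The squares of the path must stay distinct, so T is appended only if it is new. *)
  show ?thesis
  proof (cases "T \<in> set ss")
    case True
    then show ?thesis
      using path_in_component[of ss occ] ss by blast
  next
    case False
    then have "set (ss @ [T]) \<subseteq> origin_component occ"
      using ss assms by (intro path_in_component) (auto simp: successively_append_iff)
    then show ?thesis by simp
  qed
qed

lemma origin_component_star_connected:
  assumes ne: "Q \<inter> origin_component occ \<noteq> {}"
    and closed: "\<And>S T. S \<in> Q \<Longrightarrow> S \<in> origin_component occ \<Longrightarrow> T \<in> origin_component occ \<Longrightarrow>
      star_adj S T \<Longrightarrow> T \<in> Q"
  shows "origin_component occ \<subseteq> Q"
proof -
  have reach: "set ss \<subseteq> Q" if "S \<in> set ss" "S \<in> Q"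
    "ss \<noteq> []" "hd ss = (0, 0)" "distinct ss" "set ss \<subseteq> occ" "successively star_adj ss" for ss S
  proof (rule successively_closed[of star_adj])
    show "set ss \<inter> Q \<noteq> {}"
      using that by blast
    show "y \<in> Q" if "x \<in> Q" "x \<in> set ss" "y \<in> set ss" "star_adj x y" for x y
      using path_in_component[of ss occ] that closed \<open>ss \<noteq> []\<close> \<open>hd ss = (0, 0)\<close> \<open>distinct ss\<close>
        \<open>set ss \<subseteq> occ\<close> \<open>successively star_adj ss\<close> by blast
  qed (use that star_adj_sym in blast)+
  obtain S ss where "S \<in> Q" "ss \<noteq> []" "hd ss = (0, 0)" "last ss = S" "distinct ss" "set ss \<subseteq> occ"
    "successively star_adj ss"
    using ne unfolding origin_component_def by blast
  with reach[of S ss] have origin: "(0, 0) \<in> Q"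
    using hd_in_set[of ss] last_in_set[of ss] by auto
  show ?thesis
  proof
    fix T assume "T \<in> origin_component occ"
    then obtain ts where "ts \<noteq> []" "hd ts = (0, 0)" "last ts = T" "distinct ts" "set ts \<subseteq> occ"
      "successively star_adj ts"
      unfolding origin_component_def by blast
    with reach[of "(0, 0)" ts] origin show "T \<in> Q"
      using hd_in_set[of ts] last_in_set[of ts] by auto
  qed
qed

section \<open>The surrounding cycle in the dual lattice\<close>

text \<open>
  The dual lattice has the squares as its vertices and the corners of squares as its cells. The
  corner shared by the squares \<open>(i, j)\<close>, \<open>(i + 1, j)\<close>, \<open>(i, j + 1)\<close>, \<open>(i + 1, j + 1)\<close> is the dual
  cell \<open>(i, j)\<close>, so the four corners of a square are the four dual cells around a dual vertex.
\<close>

definition corner_cells :: "sq \<Rightarrow> sq set" where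
  "corner_cells S = {S, (fst S - 1, snd S), (fst S, snd S - 1), (fst S - 1, snd S - 1)}"

lemma star_adj_corner_cells:
  "star_adj S T \<longleftrightarrow> S \<noteq> T \<and> corner_cells S \<inter> corner_cells T \<noteq> {}"
proof -
  obtain i j k l where ST: "S = (i, j)" "T = (k, l)"
    by (metis surj_pair)
  have product: "corner_cells (a, b) = {a, a - 1} \<times> {b, b - 1}" for a b
    by (auto simp: corner_cells_def)
  have "{a, a - 1} \<inter> {b, b - 1} \<noteq> {} \<longleftrightarrow> \<bar>a - b\<bar> \<le> 1" for a b :: int
    by auto
  moreover have "corner_cells S \<inter> corner_cells T \<noteq> {} \<longleftrightarrow>
      {i, i - 1} \<inter> {k, k - 1} \<noteq> {} \<and> {j, j - 1} \<inter> {l, l - 1} \<noteq> {}"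
    unfolding ST product by blast
  ultimately show ?thesis
    unfolding ST star_adj_iff by simp
qed

lemma plus_adj_imp_star_adj:
  assumes "plus_adj S T"
  shows "star_adj S T"
proof -
  obtain i j k l where ST: "S = (i, j)" "T = (k, l)"
    by (metis surj_pair)
  show ?thesis
    using assms unfolding ST plus_adj_iff star_adj_iff by auto
qed

lemma cell_of_incident_edge:
  assumes "v \<in> e" "e \<in> cell_edges S"
  shows "S \<in> corner_cells v"
  using assms by (cases S) (auto simp: cell_edges_def hedge_def vedge_def corner_cells_def)

text \<open>
  Walking around a vertex that is not on the boundary crosses no boundary edge.
\<close>

lemma corner_cells_same_side:
  assumes "v \<notin> \<Union>(cell_boundary X)" "S \<in> corner_cells v" "T \<in> corner_cells v"
  shows "S \<in> X \<longleftrightarrow> T \<in> X"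
proof -
  obtain i j where v: "v = (i, j)"
    by (cases v)
  have "hedge (i, j) \<notin> cell_boundary X" "hedge (i - 1, j) \<notin> cell_boundary X"
    "vedge (i, j) \<notin> cell_boundary X"
    using assms(1) unfolding v by (auto simp: hedge_def vedge_def)
  with assms(2,3) show ?thesis
    unfolding v corner_cells_def hedge_in_cell_boundary vedge_in_cell_boundary by auto
qed

lemma lattice_edge_plus_adj:
  assumes "{u, v} \<in> range hedge \<union> range vedge"
  shows "plus_adj u v"
  using assms
  by (cases u; cases v; cases rule: lattice_edge_cases)
    (auto simp: hedge_def vedge_def doubleton_eq_iff plus_adj_iff)

text \<open>
  The four corners of one square form a plus-connected block of dual cells, and the blocks of
  star-adjacent squares overlap: star-connectedness of squares becomes plus-connectedness of
  corners.
\<close>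

lemma plus_connected_corners:
  assumes "C = origin_component occ"
  shows "plus_connected (\<Union>S\<in>C. corner_cells S)"
  unfolding plus_connected_def
proof (intro allI impI)
  let ?L = "\<Union>S\<in>C. corner_cells S"
  fix X assume closed: "\<forall>s\<in>X \<inter> ?L. \<forall>t\<in>?L. plus_adj s t \<longrightarrow> t \<in> X" and ne: "X \<inter> ?L \<noteq> {}"
  have all: "corner_cells S \<subseteq> X" if S: "S \<in> C" "corner_cells S \<inter> X \<noteq> {}" for S
  proof -
    obtain i j where ij: "S = (i, j)"
      by (cases S)
    define a b c d where cells: "a = (i, j)" "b = (i - 1, j)" "c = (i, j - 1)" "d = (i - 1, j - 1)"
    have S_eq: "corner_cells S = {a, b, c, d}"
      by (simp add: corner_cells_def ij cells)
    have iff: "s \<in> X \<longleftrightarrow> t \<in> X" if "plus_adj s t" "s \<in> corner_cells S" "t \<in> corner_cells S" for s t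
      using closed that S(1) plus_adj_sym[of s t] by blast
    have "a \<in> X \<longleftrightarrow> b \<in> X"
      by (rule iff) (simp_all add: S_eq, simp add: cells plus_adj_iff)
    moreover have "a \<in> X \<longleftrightarrow> c \<in> X"
      by (rule iff) (simp_all add: S_eq, simp add: cells plus_adj_iff)
    moreover have "b \<in> X \<longleftrightarrow> d \<in> X"
      by (rule iff) (simp_all add: S_eq, simp add: cells plus_adj_iff)
    ultimately show ?thesis
      using S(2) unfolding S_eq by blast
  qed
  have "C \<subseteq> {S. corner_cells S \<inter> X \<noteq> {}}"
    unfolding assms
  proof (rule origin_component_star_connected)
    show "{S. corner_cells S \<inter> X \<noteq> {}} \<inter> origin_component occ \<noteq> {}"
      using ne assms by blast
    fix S T assume "S \<in> {S. corner_cells S \<inter> X \<noteq> {}}" "S \<in> origin_component occ" "star_adj S T"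
    then show "T \<in> {S. corner_cells S \<inter> X \<noteq> {}}"
      using all[of S] unfolding assms star_adj_corner_cells by blast
  qed
  with all show "?L \<subseteq> X"
    by blast
qed

text \<open>
  The cycle is the boundary, in the dual lattice, of the filled set \<open>F\<close> of all corners of squares
  in the component. A square on this boundary has a corner outside \<open>F\<close>, so it is not in the
  component; since a step out of a filling starts in the original set, it also shares a corner with
  a square of the component, so it is in the vacant boundary. As the vertices of a simple cycle, these squares are pairwise distinct.
\<close>

lemma surrounding_cycle:
  assumes occ: "(0, 0) \<in> occ" and fin: "finite (origin_component occ)"
  obtains ys where "distinct ys" "plus_S_cycle ys" "set ys \<subseteq> vacant_boundary occ"
    "origin_component occ \<union> vacant_boundary occ \<subseteq> fill (set ys)"
proof -
  define C where "C = origin_component occ"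
  define L where "L = (\<Union>S\<in>C. corner_cells S)"
  define F where "F = fill L"
  have "finite L"
    unfolding L_def using fin by (simp add: C_def corner_cells_def)
  moreover have "L \<noteq> {}"
    using origin_in_component[OF occ] unfolding L_def C_def corner_cells_def by blast
  moreover have "plus_connected L"
    unfolding L_def C_def using plus_connected_corners by blast
  ultimately obtain ys where ys: "3 \<le> length ys" "distinct ys" "closed_path_edges ys = cell_boundary F"
    using boundary_fill_is_cycle[of L] unfolding F_def by metis
  have set_ys: "set ys = \<Union>(cell_boundary F)"
  proof -
    have step: "Suc i mod length ys < length ys" for i
      using ys(1) by (intro mod_less_divisor) linarith
    have "set ys = \<Union>(closed_path_edges ys)"
    proof (intro equalityI subsetI)
      fix v assume "v \<in> set ys"
      then obtain i where "i < length ys" "v = ys ! i"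
        by (metis in_set_conv_nth)
      then show "v \<in> \<Union>(closed_path_edges ys)"
        unfolding closed_path_edges_def by blast
    next
      fix v assume "v \<in> \<Union>(closed_path_edges ys)"
      then obtain i where "i < length ys" "v = ys ! i \<or> v = ys ! (Suc i mod length ys)"
        unfolding closed_path_edges_def by blast
      then show "v \<in> set ys"
        using step[of i] nth_mem by metis
    qed
    then show ?thesis
      by (simp only: ys(3))
  qed
  have "finite F"
    unfolding F_def using \<open>finite L\<close> by (rule finite_fill)
  have C_inside: "corner_cells S \<subseteq> F" if "S \<in> C" for S
    using that subset_fill[of L] unfolding F_def L_def by blast
  have "plus_S_cycle ys"
  proof -
    have "plus_adj (ys ! i) (ys ! (Suc i mod length ys))" if "i < length ys" for i
    proof (rule lattice_edge_plus_adj)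
      show "{ys ! i, ys ! (Suc i mod length ys)} \<in> range hedge \<union> range vedge"
        using that cell_boundary_lattice[of F] unfolding ys(3)[symmetric] closed_path_edges_def by blast
    qed
    note step = this
    have "ys \<noteq> []"
      using ys(1) by auto
    moreover have "successively plus_adj ys"
      unfolding successively_conv_nth
    proof (intro allI impI)
      fix i assume "Suc i < length ys"
      with step[of i] show "plus_adj (ys ! i) (ys ! Suc i)"
        by simp
    qed
    moreover have "plus_adj (last ys) (hd ys)"
      using step[of "length ys - 1"] \<open>ys \<noteq> []\<close> by (simp add: last_conv_nth hd_conv_nth)
    ultimately show ?thesis
      by (simp add: plus_S_cycle_def plus_S_path_def)
  qed
  moreover have "set ys \<subseteq> vacant_boundary occ"
  proof
    fix v assume "v \<in> set ys"
    then obtain e where e: "e \<in> cell_boundary F" "v \<in> e"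
      unfolding set_ys by blast
    from e(1) obtain S T where ST: "S \<in> F" "T \<notin> F" "plus_adj S T" "e \<in> cell_edges S" "e \<in> cell_edges T"
      by (rule cell_boundaryE)
    have "v \<notin> C"
      using cell_of_incident_edge[OF e(2) ST(5)] C_inside ST(2) by blast
    have "S \<in> L"
      using fill_exit ST(1-3) unfolding F_def by blast
    then obtain c where c: "c \<in> C" "S \<in> corner_cells c"
      unfolding L_def by blast
    have adj: "star_adj v c"
      using cell_of_incident_edge[OF e(2) ST(4)] c \<open>v \<notin> C\<close> unfolding star_adj_corner_cells by blast
    have "v \<notin> occ"
      using origin_component_closed[of c occ v] adj star_adj_sym \<open>v \<notin> C\<close> c(1) unfolding C_def by blast
    with adj c(1) show "v \<in> vacant_boundary occ"
      unfolding vacant_boundary_def C_def by blast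
  qed
  moreover have "C \<union> vacant_boundary occ \<subseteq> fill (set ys)"
  proof -
    (* A square of H off the cycle has all its corners in F, hence each of its neighbours
       has a corner in F: away from the cycle, H is a union of holes of the cycle. *)
    define H where "H = {S. corner_cells S \<inter> F \<noteq> {}}"
    have "finite H"
    proof (rule finite_subset)
      show "H \<subseteq> (\<Union>T\<in>F. {T, (fst T + 1, snd T), (fst T, snd T + 1), (fst T + 1, snd T + 1)})"
      proof
        fix S assume "S \<in> H"
        then obtain T where T: "T \<in> F" "T \<in> corner_cells S"
          unfolding H_def by blast
        from T(2) have "S \<in> {T, (fst T + 1, snd T), (fst T, snd T + 1), (fst T + 1, snd T + 1)}"
          unfolding corner_cells_def by (cases S) auto
        with T(1) show "S \<in> (\<Union>T\<in>F. {T, (fst T + 1, snd T), (fst T, snd T + 1), (fst T + 1, snd T + 1)})"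
          by blast
      qed
      show "finite (\<Union>T\<in>F. {T, (fst T + 1, snd T), (fst T, snd T + 1), (fst T + 1, snd T + 1)})"
        using \<open>finite F\<close> by simp
    qed
    have "hole_of (set ys) (H - set ys)"
      unfolding hole_of_def
    proof (intro conjI ballI allI impI)
      fix x t assume x: "x \<in> H - set ys" and adj: "plus_adj x t"
      have "x \<notin> \<Union>(cell_boundary F)"
        using x by (simp add: set_ys)
      note same_side = corner_cells_same_side[OF this]
      obtain S where "S \<in> corner_cells x" "S \<in> F"
        using x unfolding H_def by blast
      then have "corner_cells x \<subseteq> F"
        using same_side[of S] by blast
      moreover have "corner_cells x \<inter> corner_cells t \<noteq> {}"
        using plus_adj_imp_star_adj[OF adj] unfolding star_adj_corner_cells by blast
      ultimately show "t \<in> H - set ys \<union> set ys"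
        unfolding H_def by blast
    next
      show "finite (H - set ys)"
        using \<open>finite H\<close> by simp
    qed blast
    then have "H \<subseteq> fill (set ys)"
      using hole_subset_fill[of "set ys" "H - set ys"] subset_fill[of "set ys"] by blast
    moreover have "C \<union> vacant_boundary occ \<subseteq> H"
    proof
      fix S assume "S \<in> C \<union> vacant_boundary occ"
      then obtain c where "c \<in> C" "S = c \<or> star_adj S c"
        unfolding vacant_boundary_def C_def by blast
      moreover have "S \<in> corner_cells S"
        by (simp add: corner_cells_def)
      ultimately have "corner_cells S \<inter> corner_cells c \<noteq> {}"
        unfolding star_adj_corner_cells by blast
      then show "S \<in> H"
        using C_inside[OF \<open>c \<in> C\<close>] unfolding H_def by blast
    qed
    ultimately show ?thesis by blast
  qed
  ultimately show thesis
    using that ys(2) unfolding C_def by blast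
qed

section \<open>Existence and uniqueness\<close>

theorem theorem1:
  fixes occ :: "sq set"
  assumes "(0, 0) \<in> occ"
    and "finite (origin_component occ)"
  shows "\<exists>ys. enclosing_S_cycle occ ys \<and> distinct ys \<and>
           (\<forall>zs. enclosing_S_cycle occ zs \<longrightarrow>
              outermost_boundary (set zs) = outermost_boundary (set ys) \<and>
              bordering_squares (set zs) = bordering_squares (set ys))"
proof -
  let ?A = "origin_component occ \<union> vacant_boundary occ"
  have connected: "plus_connected (set zs)" "finite (set zs)" "set zs \<noteq> {}" if "plus_S_cycle zs" for zs
    using that plus_connected_plus_S_cycle by (auto simp: plus_S_cycle_def plus_S_path_def)
  have determined:
    "outermost_boundary (set zs) = (`) lattice_point ` cell_boundary (fill ?A) \<and>
     bordering_squares (set zs) = {S \<in> fill ?A. cell_edges S \<inter> cell_boundary (fill ?A) \<noteq> {}}"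
    if zs: "enclosing_S_cycle occ zs" for zs
  proof -
    have cycle: "plus_S_cycle zs" and sub: "set zs \<subseteq> ?A"
      using zs by (auto simp: enclosing_S_cycle_def)
    note L = connected[OF cycle]
    have "?A \<subseteq> fill (set zs)"
      using zs subset_fill[of "set zs"]
      unfolding enclosing_S_cycle_def interior_inside_iff_filled[OF L] by blast
    (* The squares of zs lie in A and A lies in their filling, so both have the same closure. *)
    then have "fill (set zs) = fill ?A"
      using fill_mono[OF sub] fill_least[OF L(2)] by blast
    then show ?thesis
      using outermost_boundary_is_cycle(1)[OF L] bordering_squares_eq[OF L] by simp
  qed
  obtain ys where ys: "distinct ys" "plus_S_cycle ys" "set ys \<subseteq> vacant_boundary occ"
    "?A \<subseteq> fill (set ys)"
    using surrounding_cycle[OF assms] .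
  note L = connected[OF ys(2)]
  have enclosing: "enclosing_S_cycle occ ys"
    using ys outermost_boundary_is_cycle(2)[OF L]
    unfolding enclosing_S_cycle_def interior_inside_iff_filled[OF L] by blast
  show ?thesis
  proof (intro exI conjI allI impI)
    fix zs assume "enclosing_S_cycle occ zs"
    from determined[OF this] determined[OF enclosing]
    show "outermost_boundary (set zs) = outermost_boundary (set ys)"
      and "bordering_squares (set zs) = bordering_squares (set ys)"
      by simp_all
  qed (fact enclosing, fact ys(1))
qed

end
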